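(* Let $n\ge4$, let $Q$ be a Dynkin quiver of type $D_n$, and let $\rho$ be a shallow maximal $S$-sectional (resp. $N$-sectional) path in $\Gamma_Q$. Then there exists $k\le n-2+\delta$ such that all roots in $\rho$ contain $-\varepsilon_k$ as a summand, and $\rho$ starts (resp. ends) at level $1$. Here $\delta=1$ if $n-1$ and $n$ are both sinks or both sources of $Q$, and $\delta=0$ otherwise.
   Context: Type $D_n$ and the AR-quiver. $\Delta_n$ ($n\ge4$) is the Dynkin diagram of type $D_n$ with vertex set $I_0=\{1,\dots,n\}$ and edges $i - (i+1)$ for $1\le i\le n-2$ and $(n-2) - n$. With $\varepsilon_1,\dots,\varepsilon_n$ orthonormal, $\alpha_i=\varepsilon_i-\varepsilon_{i+1}$ ($i\le n-1$), $\alpha_n=\varepsilon_{n-1}+\varepsilon_n$, and $\Phi_n^+=\{\varepsilon_a\pm\varepsilon_b : 1\le a<b\le n\}$; $\varepsilon_a$ and $\pm\varepsilon_b$ are called the summands of $\varepsilon_a\pm\varepsilon_b$. A Dynkin quiver $Q$ of type $D_n$ is an orientation of $\Delta_n$. Fix a height function $\xi:I_0\to\mathbb Z$, i.e. $\xi_j=\xi_i-1$ whenever $i\to j$ in $Q$. For $i\in I_0$ let $\eta_i=\sum_j\alpha_j$, the sum over all $j$ admitting a (possibly trivial) path from $j$ to $i$ in $Q$. Let $s_iQ$ be $Q$ with all arrows at $i$ reversed, and let $\tau=s_{i_1}\cdots s_{i_n}$ be the Coxeter element adapted to $Q$: $\{i_1,\dots,i_n\}=I_0$ and $i_k$ is a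 source of $s_{i_{k-1}}\cdots s_{i_1}Q$ for all $k$. Put $m_i=\max\{k\ge 0:\tau^k(\eta_i)\in\Phi_n^+\}$. The Auslander-Reiten quiver $\Gamma_Q$ has vertices $(i,\xi_i-2k)$ with $i\in I_0$, $0\le k\le m_i$, and arrows $(i,p)\to(j,p+1)$ for $i,j$ adjacent in $\Delta_n$. Its vertices are identified with $\Phi_n^+$ by $(i,\xi_i-2k)\leftrightarrow\tau^k(\eta_i)$. If $\beta\leftrightarrow(i,p)$, the level of $\beta$ is $i$. Sectional paths. An $S$-sectional path is a connected subquiver of $\Gamma_Q$ that is a concatenation of arrows of the form $(i,p)\to(i+1,p+1)$ ($1\le i\le n-2$) or $(n-2,p)\to(n,p+1)$. An $N$-sectional path is a connected concatenation of arrows of the form $(i,p)\to(i-1,p+1)$ ($2\le i\le n-1$) or $(n,p)\to(n-2,p+1)$. Such a path is maximal if no bigger path of the same kind contains all its roots. A maximal $S$-sectional (resp. $N$-sectional) path is shallow if it ends (resp. starts) at a level less than $n-1$.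
   Formalization: The maximum defining m_i does not exist as written, since τ has finite order and τ^k(η_i) is positive for arbitrarily large k; m_i is taken as the largest k such that τ^l(η_i) is a positive root for all 0 ≤ l ≤ k. *)

theory Defs
  imports "HOL-Analysis.Analysis"
begin

text \<open>The roots live in an arbitrary real inner product space, in which
  \<open>\<epsilon> 1, \<dots>, \<epsilon> n\<close> is a given orthonormal family. Values of \<open>\<epsilon>\<close> outside \<open>{1..n}\<close> are irrelevant.\<close>

definition orthonormal :: "nat \<Rightarrow> (nat \<Rightarrow> 'a::real_inner) \<Rightarrow> bool" where
  "orthonormal n \<epsilon> \<longleftrightarrow>
     (\<forall>i\<in>{1..n}. \<forall>j\<in>{1..n}. \<epsilon> i \<bullet> \<epsilon> j = (if i = j then 1 else 0))"

definition simple_root :: "nat \<Rightarrow> (nat \<Rightarrow> 'a::real_inner) \<Rightarrow> nat \<Rightarrow> 'a" where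
  "simple_root n \<epsilon> i = (if i = n then \<epsilon> (n - 1) + \<epsilon> n else \<epsilon> i - \<epsilon> (i + 1))"

definition positive_roots :: "nat \<Rightarrow> (nat \<Rightarrow> 'a::real_inner) \<Rightarrow> 'a set" where
  "positive_roots n \<epsilon> =
     {\<epsilon> a - \<epsilon> b | a b. 1 \<le> a \<and> a < b \<and> b \<le> n} \<union> {\<epsilon> a + \<epsilon> b | a b. 1 \<le> a \<and> a < b \<and> b \<le> n}"

definition summand :: "nat \<Rightarrow> (nat \<Rightarrow> 'a::real_inner) \<Rightarrow> 'a \<Rightarrow> 'a \<Rightarrow> bool" where
  "summand n \<epsilon> v \<beta> \<longleftrightarrow>
     (\<exists>a b. 1 \<le> a \<and> a < b \<and> b \<le> n \<and>
        (\<beta> = \<epsilon> a - \<epsilon> b \<and> v \<in> {\<epsilon> a, - \<epsilon> b} \<or> \<beta> = \<epsilon> a + \<epsilon> b \<and> v \<in> {\<epsilon> a, \<epsilon> b}))"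

definition simple_reflection :: "nat \<Rightarrow> (nat \<Rightarrow> 'a::real_inner) \<Rightarrow> nat \<Rightarrow> 'a \<Rightarrow> 'a" where
  "simple_reflection n \<epsilon> i v =
     (let \<alpha> = simple_root n \<epsilon> i in v - (2 * (v \<bullet> \<alpha>) / (\<alpha> \<bullet> \<alpha>)) *\<^sub>R \<alpha>)"

definition diagram_edges :: "nat \<Rightarrow> nat set set" where
  "diagram_edges n = {{i, i + 1} | i. 1 \<le> i \<and> i \<le> n - 2} \<union> {{n - 2, n}}"

text \<open>A quiver on the vertex set \<open>{1..n}\<close> is given by its set of arrows, \<open>(i, j)\<close> standing
  for \<open>i \<rightarrow> j\<close>.\<close>

definition dynkin_quiver :: "nat \<Rightarrow> (nat \<times> nat) set \<Rightarrow> bool" where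
  "dynkin_quiver n Q \<longleftrightarrow>
     (\<forall>(i, j)\<in>Q. {i, j} \<in> diagram_edges n) \<and>
     (\<forall>i j. {i, j} \<in> diagram_edges n \<longrightarrow> ((i, j) \<in> Q) \<noteq> ((j, i) \<in> Q))"

definition height_function :: "(nat \<times> nat) set \<Rightarrow> (nat \<Rightarrow> int) \<Rightarrow> bool" where
  "height_function Q \<xi> \<longleftrightarrow> (\<forall>(i, j)\<in>Q. \<xi> j = \<xi> i - 1)"

definition source_of :: "(nat \<times> nat) set \<Rightarrow> nat \<Rightarrow> bool" where
  "source_of Q i \<longleftrightarrow> (\<forall>j. (j, i) \<notin> Q)"

definition sink_of :: "(nat \<times> nat) set \<Rightarrow> nat \<Rightarrow> bool" where
  "sink_of Q i \<longleftrightarrow> (\<forall>j. (i, j) \<notin> Q)"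

definition reverse_at :: "nat \<Rightarrow> (nat \<times> nat) set \<Rightarrow> (nat \<times> nat) set" where
  "reverse_at i Q = {(a, b). if a = i \<or> b = i then (b, a) \<in> Q else (a, b) \<in> Q}"

text \<open>In the following two definitions the list \<open>w\<close> is \<open>[i\<^sub>1, \<dots>, i\<^sub>n]\<close>, with \<open>i\<^sub>k = w ! (k - 1)\<close>.\<close>

definition adapted_word :: "nat \<Rightarrow> (nat \<times> nat) set \<Rightarrow> nat list \<Rightarrow> bool" where
  "adapted_word n Q w \<longleftrightarrow>
     length w = n \<and> set w = {1..n} \<and>
     (\<forall>k<n. source_of (fold reverse_at (take k w) Q) (w ! k))"

definition adapted_coxeter ::
  "nat \<Rightarrow> (nat \<Rightarrow> 'a::real_inner) \<Rightarrow> (nat \<times> nat) set \<Rightarrow> ('a \<Rightarrow> 'a) \<Rightarrow> bool" where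
  "adapted_coxeter n \<epsilon> Q \<tau> \<longleftrightarrow>
     (\<exists>w. adapted_word n Q w \<and> \<tau> = foldr (\<lambda>i f. simple_reflection n \<epsilon> i \<circ> f) w id)"

definition eta :: "nat \<Rightarrow> (nat \<Rightarrow> 'a::real_inner) \<Rightarrow> (nat \<times> nat) set \<Rightarrow> nat \<Rightarrow> 'a" where
  "eta n \<epsilon> Q i = (\<Sum>j | j \<in> {1..n} \<and> (j, i) \<in> Q\<^sup>*. simple_root n \<epsilon> j)"

text \<open>Since \<open>\<tau>\<close> has finite order on the roots, \<open>\<tau>\<^sup>k(\<eta>\<^sub>i)\<close> is a positive root for arbitrarily large \<open>k\<close>.
  The maximum in the definition of \<open>m\<^sub>i\<close> is therefore taken over the initial segment of those \<open>k\<close>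
  for which none of \<open>\<tau>\<^sup>0(\<eta>\<^sub>i), \<dots>, \<tau>\<^sup>k(\<eta>\<^sub>i)\<close> has left the positive roots.\<close>

definition m_index ::
  "nat \<Rightarrow> (nat \<Rightarrow> 'a::real_inner) \<Rightarrow> (nat \<times> nat) set \<Rightarrow> ('a \<Rightarrow> 'a) \<Rightarrow> nat \<Rightarrow> nat" where
  "m_index n \<epsilon> Q \<tau> i = Max {k. \<forall>l\<le>k. (\<tau> ^^ l) (eta n \<epsilon> Q i) \<in> positive_roots n \<epsilon>}"

definition AR_vertices ::
  "nat \<Rightarrow> (nat \<Rightarrow> 'a::real_inner) \<Rightarrow> (nat \<times> nat) set \<Rightarrow> (nat \<Rightarrow> int) \<Rightarrow> ('a \<Rightarrow> 'a) \<Rightarrow> (nat \<times> int) set" where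
  "AR_vertices n \<epsilon> Q \<xi> \<tau> = {(i, \<xi> i - 2 * int k) | i k. i \<in> {1..n} \<and> k \<le> m_index n \<epsilon> Q \<tau> i}"

definition AR_arrows ::
  "nat \<Rightarrow> (nat \<Rightarrow> 'a::real_inner) \<Rightarrow> (nat \<times> nat) set \<Rightarrow> (nat \<Rightarrow> int) \<Rightarrow> ('a \<Rightarrow> 'a)
     \<Rightarrow> ((nat \<times> int) \<times> (nat \<times> int)) set" where
  "AR_arrows n \<epsilon> Q \<xi> \<tau> =
     {((i, p), (j, p + 1)) | i j p. {i, j} \<in> diagram_edges n \<and>
        (i, p) \<in> AR_vertices n \<epsilon> Q \<xi> \<tau> \<and> (j, p + 1) \<in> AR_vertices n \<epsilon> Q \<xi> \<tau>}"

text \<open>The positive root \<open>\<tau>\<^sup>k(\<eta>\<^sub>i)\<close> identified with the vertex \<open>(i, \<xi>\<^sub>i - 2k)\<close>.\<close>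

definition AR_root ::
  "nat \<Rightarrow> (nat \<Rightarrow> 'a::real_inner) \<Rightarrow> (nat \<times> nat) set \<Rightarrow> (nat \<Rightarrow> int) \<Rightarrow> ('a \<Rightarrow> 'a) \<Rightarrow> nat \<times> int \<Rightarrow> 'a" where
  "AR_root n \<epsilon> Q \<xi> \<tau> = (\<lambda>(i, p). (\<tau> ^^ nat ((\<xi> i - p) div 2)) (eta n \<epsilon> Q i))"

definition level :: "nat \<times> int \<Rightarrow> nat" where
  "level v = fst v"

definition S_arrows ::
  "nat \<Rightarrow> (nat \<Rightarrow> 'a::real_inner) \<Rightarrow> (nat \<times> nat) set \<Rightarrow> (nat \<Rightarrow> int) \<Rightarrow> ('a \<Rightarrow> 'a)
     \<Rightarrow> ((nat \<times> int) \<times> (nat \<times> int)) set" where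
  "S_arrows n \<epsilon> Q \<xi> \<tau> = AR_arrows n \<epsilon> Q \<xi> \<tau> \<inter>
     ({((i, p), (i + 1, p + 1)) | i p. 1 \<le> i \<and> i \<le> n - 2} \<union> {((n - 2, p), (n, p + 1)) | p. True})"

definition N_arrows ::
  "nat \<Rightarrow> (nat \<Rightarrow> 'a::real_inner) \<Rightarrow> (nat \<times> nat) set \<Rightarrow> (nat \<Rightarrow> int) \<Rightarrow> ('a \<Rightarrow> 'a)
     \<Rightarrow> ((nat \<times> int) \<times> (nat \<times> int)) set" where
  "N_arrows n \<epsilon> Q \<xi> \<tau> = AR_arrows n \<epsilon> Q \<xi> \<tau> \<inter>
     ({((i, p), (i - 1, p + 1)) | i p. 2 \<le> i \<and> i \<le> n - 1} \<union> {((n, p), (n - 2, p + 1)) | p. True})"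

text \<open>A path with vertices in \<open>V\<close> and arrows in \<open>A\<close> is given by the nonempty list of its successive
  vertices. Single vertices (paths without arrows) are included: for instance, the only positive root
  with summand \<open>- \<epsilon> 2\<close> is \<open>\<epsilon> 1 - \<epsilon> 2\<close>.\<close>

definition path_in :: "'v set \<Rightarrow> ('v \<times> 'v) set \<Rightarrow> 'v list \<Rightarrow> bool" where
  "path_in V A \<rho> \<longleftrightarrow> \<rho> \<noteq> [] \<and> set \<rho> \<subseteq> V \<and> successively (\<lambda>u v. (u, v) \<in> A) \<rho>"

definition maximal_path_in :: "'v set \<Rightarrow> ('v \<times> 'v) set \<Rightarrow> 'v list \<Rightarrow> bool" where
  "maximal_path_in V A \<rho> \<longleftrightarrow> path_in V A \<rho> \<and> \<not> (\<exists>\<rho>'. path_in V A \<rho>' \<and> set \<rho> \<subset> set \<rho>')"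

definition shallow_maximal_S_path ::
  "nat \<Rightarrow> (nat \<Rightarrow> 'a::real_inner) \<Rightarrow> (nat \<times> nat) set \<Rightarrow> (nat \<Rightarrow> int) \<Rightarrow> ('a \<Rightarrow> 'a)
     \<Rightarrow> (nat \<times> int) list \<Rightarrow> bool" where
  "shallow_maximal_S_path n \<epsilon> Q \<xi> \<tau> \<rho> \<longleftrightarrow>
     maximal_path_in (AR_vertices n \<epsilon> Q \<xi> \<tau>) (S_arrows n \<epsilon> Q \<xi> \<tau>) \<rho> \<and> level (last \<rho>) < n - 1"

definition shallow_maximal_N_path ::
  "nat \<Rightarrow> (nat \<Rightarrow> 'a::real_inner) \<Rightarrow> (nat \<times> nat) set \<Rightarrow> (nat \<Rightarrow> int) \<Rightarrow> ('a \<Rightarrow> 'a)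
     \<Rightarrow> (nat \<times> int) list \<Rightarrow> bool" where
  "shallow_maximal_N_path n \<epsilon> Q \<xi> \<tau> \<rho> \<longleftrightarrow>
     maximal_path_in (AR_vertices n \<epsilon> Q \<xi> \<tau>) (N_arrows n \<epsilon> Q \<xi> \<tau>) \<rho> \<and> level (hd \<rho>) < n - 1"

definition delta :: "nat \<Rightarrow> (nat \<times> nat) set \<Rightarrow> nat" where
  "delta n Q =
     (if sink_of Q (n - 1) \<and> sink_of Q n \<or> source_of Q (n - 1) \<and> source_of Q n then 1 else 0)"

end

theory Submission
  imports Defs
begin

text \<open>All roots of \<open>\<Gamma>\<^sub>Q\<close> can be read off from a single two-sided sequence \<open>f\<close> of signed basis
  vectors \<open>\<plusminus>\<epsilon>\<^sub>x\<close> (called \<open>orbit\<close> below). It is indexed by integers of one parity and satisfies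
  \<open>f (q - 2) = \<tau> (f q)\<close> and \<open>f (q - 2 (n - 1)) = - f q\<close>; up to sign it runs through all basis vectors
  but one, \<open>\<epsilon>\<^sub>m\<close> with \<open>m \<in> {n - 1, n}\<close>, for which \<open>\<tau> \<epsilon>\<^sub>m = - \<epsilon>\<^sub>m\<close>. The vertex \<open>(i, p)\<close> with
  \<open>i \<le> n - 2\<close> carries the root \<open>f (p + i) - f (p - i)\<close>, the solution of the mesh relations that
  vanishes at level \<open>0\<close>; the vertices \<open>(n - 1, p)\<close> and \<open>(n, p)\<close> carry \<open>f (p + n - 1) \<plusminus> \<epsilon>\<^sub>m\<close>. An
  \<open>S\<close>-sectional path below the levels \<open>n - 1, n\<close> keeps \<open>p - i\<close> fixed, hence all its roots share the
  summand \<open>- f (p - i)\<close>; an \<open>N\<close>-sectional path keeps \<open>p + i\<close> fixed, and all its roots share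
  \<open>f (p + i)\<close>. It remains to see that this common summand is \<open>- \<epsilon>\<^sub>k\<close> for a small \<open>k\<close>, which is
  decided at the end of the path where it stops being extendable.

  The place of \<open>\<epsilon>\<^sub>x\<close> in \<open>f\<close> is a number \<open>slot x\<close> depending only on the heights at \<open>x\<close> and \<open>x - 1\<close>:
  it is \<open>\<xi>\<^sub>x + x\<close> if \<open>x = 1\<close> or \<open>x \<rightarrow> x - 1\<close>, and \<open>\<xi>\<^sub>x - x + 2\<close> if \<open>x - 1 \<rightarrow> x\<close>. So the window
  \<open>[\<xi>\<^sub>z - z + 2, \<xi>\<^sub>z + z]\<close> contains precisely the slots of \<open>\<epsilon>\<^sub>1, \<dots>, \<epsilon>\<^sub>z\<close>: within half a period the
  indices grow as one moves away from the slot of \<open>\<epsilon>\<^sub>1\<close> in either direction. This shape gives the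
  positivity of \<open>\<tau>\<^sup>k (\<eta>\<^sub>i)\<close> for \<open>k \<le> n - 2\<close> (lemmas \<open>slot_order\<close>, \<open>low_root_positive\<close>), and with the
  antiperiodicity it shows that each level \<open>i \<le> n - 2\<close> consists of the vertices \<open>(i, \<xi>\<^sub>i - 2k)\<close> with
  \<open>0 \<le> k \<le> n - 2\<close>.

  Consequently a shallow maximal \<open>S\<close>-path ends at a vertex \<open>(i, \<xi>\<^sub>i)\<close> such that \<open>i\<close> has arrows to its
  neighbours of larger index, where \<open>f (\<xi>\<^sub>i - i) = \<epsilon>\<^sub>i\<^sub>+\<^sub>1\<close> by the slot formula. A shallow maximal
  \<open>N\<close>-path starts at a vertex \<open>(i, \<xi>\<^sub>i - 2 (n - 2))\<close> such that \<open>i\<close> receives arrows from those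
  neighbours, and there \<open>f (p + i) = - f (\<xi>\<^sub>i + i + 2) = - \<epsilon>\<^sub>i\<^sub>+\<^sub>1\<close>. The value \<open>k = i + 1 = n - 1\<close> occurs
  only for \<open>i = n - 2\<close>, when \<open>n - 1\<close> and \<open>n\<close> are both sinks or both sources, that is, when \<open>\<delta> = 1\<close>.
  The other end of the path is at level \<open>1\<close>, because along such a line of slope \<open>\<plusminus>1\<close> the band of
  vertices cannot be left earlier.

  That \<open>\<tau>\<close> shifts \<open>f\<close> is proved without computing \<open>\<tau>\<close>. The placement of the vectors \<open>\<plusminus>\<epsilon>\<^sub>x\<close> on the
  integers makes sense for every height function, and the reflection at a source \<open>i\<close> carries the
  placement for \<open>\<xi>\<close> to the placement for the height function with \<open>\<xi>\<^sub>i\<close> lowered by \<open>2\<close>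
  (\<open>placed_reflection\<close>). After a whole adapted word every height has dropped by \<open>2\<close>, which amounts to
  a translation of the placement.\<close>

section \<open>Slots of a height chain\<close>

text \<open>The place of the \<open>x\<close>-th basis vector in the sequence of signed basis vectors, for a chain of
  heights. Which formula applies depends on the direction of the arrow between \<open>x - 1\<close> and \<open>x\<close>; in
  both cases the slot of \<open>x\<close> is the position by which the window of \<open>x - 1\<close> grows to that of \<open>x\<close>.\<close>

definition slot :: "(nat \<Rightarrow> int) \<Rightarrow> nat \<Rightarrow> int" where
  "slot h x = (if x = 1 \<or> h x = h (x - 1) + 1 then h x + int x else h x - int x + 2)"

locale height_chain =
  fixes h :: "nat \<Rightarrow> int" and N :: nat
  assumes unit_step: "\<lbrakk>1 \<le> x; x < N\<rbrakk> \<Longrightarrow> \<bar>h (Suc x) - h x\<bar> = 1"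
begin

text \<open>The window of \<open>z\<close> is the interval \<open>[h z - z + 2, h z + z]\<close>; as \<open>h\<close> changes by one at each step,
  exactly one end of the window moves outwards when \<open>z\<close> increases.\<close>

lemma window_mono:
  assumes "1 \<le> x" "x \<le> y" "y \<le> N"
  shows "h x + int x \<le> h y + int y" and "h y - int y \<le> h x - int x"
proof -
  have "h x + int x \<le> h y + int y \<and> h y - int y \<le> h x - int x"
    using assms(2,3)
  proof (induction y rule: dec_induct)
    case base
    then show ?case by simp
  next
    case (step y)
    have "\<bar>h (Suc y) - h y\<bar> = 1"
      using assms(1) step.hyps step.prems by (intro unit_step) auto
    then have "h (Suc y) = h y + 1 \<or> h (Suc y) = h y - 1" by linarith
    moreover have "h x + int x \<le> h y + int y \<and> h y - int y \<le> h x - int x"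
      using step.IH step.prems by simp
    ultimately show ?case by auto
  qed
  then show "h x + int x \<le> h y + int y" and "h y - int y \<le> h x - int x" by auto
qed

lemma slot_Suc:
  assumes "1 \<le> x" "x < N"
  shows "h (Suc x) = h x + 1 \<and> slot h (Suc x) = h x + int x + 2 \<or>
         h (Suc x) = h x - 1 \<and> slot h (Suc x) = h x - int x"
  using unit_step[OF assms] assms by (auto simp: slot_def abs_if split: if_splits)

lemma slot_inside:
  assumes "1 \<le> x" "x \<le> z" "z \<le> N"
  shows "h z - int z + 2 \<le> slot h x \<and> slot h x \<le> h z + int z"
proof -
  have "h x - int x + 2 \<le> slot h x \<and> slot h x \<le> h x + int x"
    using assms(1) by (auto simp: slot_def)
  then show ?thesis using window_mono[OF assms] by linarith
qed

text \<open>A vector with index above \<open>z\<close> was added at an end of a window at least as large as that of \<open>z\<close>.\<close>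

lemma slot_outside:
  assumes "1 \<le> z" "z < x" "x \<le> N"
  shows "slot h x \<le> h z - int z \<or> h z + int z + 2 \<le> slot h x"
proof -
  obtain y where y: "x = Suc y" using assms by (cases x) auto
  show ?thesis
    using slot_Suc[of y] window_mono[of z y] assms y by auto
qed

lemma slot_inj:
  assumes "x \<in> {1..N}" "y \<in> {1..N}" "slot h x = slot h y"
  shows "x = y"
proof (rule ccontr)
  have *: False if "x' < y'" "x' \<in> {1..N}" "y' \<in> {1..N}" "slot h x' = slot h y'" for x' y'
    using slot_outside[of x' y'] slot_inside[of x' x'] that by auto
  assume "x \<noteq> y"
  then show False using *[of x y] *[of y x] assms by (cases "x < y") auto
qed

lemma period_cases:
  fixes j :: int
  shows "j \<ge> 1 \<Longrightarrow> 2 * int N * j \<ge> 2 * int N"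
    and "j \<le> -2 \<Longrightarrow> 2 * int N * j \<le> - 4 * int N"
    and "j \<le> -1 \<Longrightarrow> 2 * int N * j \<le> - 2 * int N"
  using mult_left_mono[of 1 j "2 * int N"] mult_left_mono[of j "-2" "2 * int N"]
    mult_left_mono[of j "-1" "2 * int N"] by auto

lemma small_multiple_of_period:
  fixes d D :: int
  assumes D: "D = 2 * int N * d" and small: "\<bar>D\<bar> < 2 * int N"
  shows "d = 0"
proof (rule ccontr)
  assume "d \<noteq> 0"
  then consider "d \<ge> 1" | "d \<le> -1" by linarith
  then show False
  proof cases
    case 1
    show False using period_cases(1)[OF 1] small unfolding D[symmetric] by linarith
  next
    case 2
    show False using period_cases(3)[OF 2] small unfolding D[symmetric] by linarith
  qed
qed

text \<open>All slots lie in the window of \<open>N\<close>, which is shorter than a half period \<open>2 N\<close>. So a position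
  determines the basis vector placed there and the number of half periods that separate it from the
  slot, hence also the sign.\<close>

lemma slot_inj_period:
  assumes "x \<in> {1..N}" "y \<in> {1..N}" "slot h x + 2 * int N * j = slot h y + 2 * int N * k"
  shows "x = y \<and> j = k"
proof -
  have "slot h x - slot h y = 2 * int N * (k - j)"
    using assms(3) by (simp add: algebra_simps)
  moreover have "h N - int N + 2 \<le> slot h x" "slot h x \<le> h N + int N"
    "h N - int N + 2 \<le> slot h y" "slot h y \<le> h N + int N"
    using slot_inside[of x N] slot_inside[of y N] assms(1,2) by auto
  then have "\<bar>slot h x - slot h y\<bar> < 2 * int N" by linarith
  ultimately have "k - j = 0" by (rule small_multiple_of_period)
  then have "k = j" by simp
  then show ?thesis using slot_inj[OF assms(1,2)] assms(3) by simp
qed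

text \<open>The combinatorial form of positivity. The two positions are those entering the root
  \<open>f (p + i) - f (p - i)\<close> at \<open>p = h i - 2 k\<close>; they hold the basis vectors \<open>x\<close> and \<open>y\<close>, with signs given
  by the parities of \<open>j\<close> and \<open>j'\<close>. A difference of two signed basis vectors is a positive root as soon as
  the vector of smaller index occurs in it with a positive sign, which is what the conclusion says. The
  reason is the shape of the sequence: within the window of \<open>N\<close>, indices grow in both directions away
  from the slot of \<open>\<epsilon>\<^sub>1\<close>. So the smaller index can have the wrong sign only if, within one copy of the
  window of \<open>N\<close>, the two positions lie on opposite sides of the window of \<open>i\<close>; but then their distance is
  more than \<open>2 i\<close>.\<close>

lemma slot_order:
  assumes i: "1 \<le> i" "i < N" and k: "0 \<le> k" "k \<le> int N - 1"
    and x: "x \<in> {1..N}" and y: "y \<in> {1..N}"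
    and P: "h i + int i - 2 * k = slot h x + 2 * int N * j"
    and M: "h i - int i - 2 * k = slot h y + 2 * int N * j'"
  shows "x < y \<and> j = 0 \<or> y < x \<and> j' = - 1"
proof -
  have wx: "h N - int N + 2 \<le> slot h x" "slot h x \<le> h N + int N"
    and wy: "h N - int N + 2 \<le> slot h y" "slot h y \<le> h N + int N"
    using slot_inside[of x N] slot_inside[of y N] x y by auto
  have iN: "h i + int i \<le> h N + int N" "h N - int N \<le> h i - int i"
    using window_mono[of i N] i by auto
  have j: "j = 0 \<or> j = -1"
    using period_cases(1)[of j] period_cases(2)[of j] P wx iN k i by linarith
  have j': "j' = 0 \<or> j' = -1"
    using period_cases(1)[of j'] period_cases(2)[of j'] M wy iN k i by linarith
  have "x \<noteq> y"
  proof
    assume "x = y"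
    then have "2 * int i = 2 * int N * (j - j')" using P M by (simp add: algebra_simps)
    moreover have "\<bar>2 * int i\<bar> < 2 * int N" using i by simp
    ultimately have "j - j' = 0" by (rule small_multiple_of_period)
    then show False using \<open>2 * int i = 2 * int N * (j - j')\<close> i by simp
  qed
  moreover have "j = 0" if "x < y"
  proof (rule ccontr)
    assume "j \<noteq> 0"
    then have jm: "j = -1" using j by simp
    then have jm': "j' = -1" using P M wx wy i j' by auto
    \<comment> \<open>Both vectors lie in the window of \<open>N\<close> shifted down by one half period. Then \<open>x\<close> lies above the
      window of \<open>i\<close> and \<open>y\<close>, having a larger index, below it, so that they are too far apart.\<close>
    have sx: "slot h x \<ge> h i + int i + 2" using P jm k by auto
    have "i < x" using slot_inside[of x i] sx x i by (cases "x \<le> i") auto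
    have "slot h y < slot h x" using P M jm jm' i by auto
    then have "slot h y \<le> h x - int x"
      using slot_outside[of x y] slot_inside[of x x] that x y by auto
    then have "slot h y \<le> h i - int i"
      using window_mono[of i x] \<open>i < x\<close> i x by auto
    then show False using P M jm jm' sx by auto
  qed
  moreover have "j' = -1" if "y < x"
  proof (rule ccontr)
    assume "j' \<noteq> -1"
    then have jm': "j' = 0" using j' by simp
    then have jm: "j = 0" using P M wx wy i j by auto
    \<comment> \<open>Both vectors lie in the window of \<open>N\<close> itself, \<open>y\<close> below the window of \<open>i\<close>; the larger index \<open>x\<close>
      to the right of \<open>y\<close> is then above that window, contrary to the position of \<open>x\<close>.\<close>
    have sy: "slot h y \<le> h i - int i" using M jm' k by auto
    have "i < y" using slot_inside[of y i] sy y i by (cases "y \<le> i") auto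
    have "slot h y < slot h x" using P M jm jm' i by auto
    then have "h y + int y + 2 \<le> slot h x"
      using slot_outside[of y x] slot_inside[of y y] that x y by auto
    then have "h i + int i + 2 \<le> slot h x"
      using window_mono[of i y] \<open>i < y\<close> i y by auto
    then show False using P jm k by auto
  qed
  ultimately show ?thesis by linarith
qed

end

text \<open>Lowering a local maximum \<open>i\<close> of the heights by two turns its arrows around, and the vectors
  \<open>i\<close> and \<open>i + 1\<close>, which occupy the two ends of the window of \<open>i + 1\<close>, trade places.\<close>

lemma slot_fire:
  assumes i: "1 \<le> i" and left: "i = 1 \<or> h (i - 1) = h i - 1" and right: "h (Suc i) = h i - 1"
    and x: "1 \<le> x"
  shows "slot (h(i := h i - 2)) x =
    (if x = i then slot h (Suc i) else if x = Suc i then slot h i else slot h x)"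
proof -
  consider "x = i" | "x = Suc i" | "x \<noteq> i" "x \<noteq> Suc i" "x - 1 \<noteq> i" using x by linarith
  then show ?thesis
  proof cases
    case 1
    then show ?thesis using right left i by (auto simp: slot_def)
  next
    case 2
    then show ?thesis using right left i by (auto simp: slot_def)
  next
    case 3
    then show ?thesis by (simp add: slot_def)
  qed
qed

lemma slot_cong:
  assumes "h x = h' x" "h (x - 1) = h' (x - 1)"
  shows "slot h x = slot h' x"
  using assms by (simp add: slot_def)

section \<open>Height functions on the diagram\<close>

text \<open>Heights are the only information about the quiver that is needed: an orientation is recovered from
  them, sources are their local maxima (\<open>peak\<close>), and reversing the arrows at a source is \<open>fire\<close>.\<close>

definition admissible :: "nat \<Rightarrow> (nat \<Rightarrow> int) \<Rightarrow> bool" where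
  "admissible n \<xi> \<longleftrightarrow> (\<forall>i j. {i, j} \<in> diagram_edges n \<longrightarrow> \<bar>\<xi> i - \<xi> j\<bar> = 1)"

definition peak :: "nat \<Rightarrow> (nat \<Rightarrow> int) \<Rightarrow> nat \<Rightarrow> bool" where
  "peak n \<xi> i \<longleftrightarrow> (\<forall>j. {i, j} \<in> diagram_edges n \<longrightarrow> \<xi> j = \<xi> i - 1)"

abbreviation fire :: "nat \<Rightarrow> (nat \<Rightarrow> int) \<Rightarrow> (nat \<Rightarrow> int)" where
  "fire i \<xi> \<equiv> \<xi>(i := \<xi> i - 2)"

text \<open>The sequence has one place for the pair of vectors \<open>\<epsilon> (n - 1), \<epsilon> n\<close> beyond \<open>n - 2\<close>. It is taken
  by \<open>\<epsilon> (tip n \<xi>)\<close>, and the other one is the vector that the Coxeter element negates. In case of equal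
  heights this is \<open>\<epsilon> n\<close>, because then \<open>n - 1\<close> and \<open>n\<close> are reflected in the same way and the
  product of their reflections negates it.\<close>

definition tip :: "nat \<Rightarrow> (nat \<Rightarrow> int) \<Rightarrow> nat" where
  "tip n \<xi> = (if \<xi> (n - 1) = \<xi> n then n - 1 else n)"

definition cotip :: "nat \<Rightarrow> (nat \<Rightarrow> int) \<Rightarrow> nat" where
  "cotip n \<xi> = (if \<xi> (n - 1) = \<xi> n then n else n - 1)"

text \<open>The branched diagram is replaced by the chain \<open>1, \<dots>, n - 1\<close> whose last node stands for the tip.\<close>

definition label :: "nat \<Rightarrow> (nat \<Rightarrow> int) \<Rightarrow> nat \<Rightarrow> nat" where
  "label n \<xi> x = (if x \<le> n - 2 then x else tip n \<xi>)"

definition chain :: "nat \<Rightarrow> (nat \<Rightarrow> int) \<Rightarrow> nat \<Rightarrow> int" where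
  "chain n \<xi> x = \<xi> (label n \<xi> x)"

text \<open>The graph of the sequence \<open>f\<close>: position \<open>q\<close> holds \<open>v\<close>. A relation is used because its
  compatibility with reflections can then be shown before it is known to be a function.\<close>

definition placed ::
  "nat \<Rightarrow> (nat \<Rightarrow> 'a::real_inner) \<Rightarrow> (nat \<Rightarrow> int) \<Rightarrow> int \<Rightarrow> 'a \<Rightarrow> bool" where
  "placed n \<epsilon> \<xi> q v \<longleftrightarrow> (\<exists>x\<in>{1..n - 1}. \<exists>j.
     q = slot (chain n \<xi>) x + 2 * int (n - 1) * j \<and>
     v = (if even j then \<epsilon> (label n \<xi> x) else - \<epsilon> (label n \<xi> x)))"

lemma edge_iff:
  assumes "n \<ge> 4"
  shows "{i, j} \<in> diagram_edges n \<longleftrightarrow>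
    1 \<le> i \<and> i \<le> n - 2 \<and> j = Suc i \<or> 1 \<le> j \<and> j \<le> n - 2 \<and> i = Suc j \<or>
    i = n - 2 \<and> j = n \<or> i = n \<and> j = n - 2"
  using assms by (auto simp: diagram_edges_def doubleton_eq_iff)

lemma admissibleD:
  assumes "n \<ge> 4" "admissible n \<xi>"
  shows "\<lbrakk>1 \<le> i; i \<le> n - 2\<rbrakk> \<Longrightarrow> \<xi> (Suc i) = \<xi> i + 1 \<or> \<xi> (Suc i) = \<xi> i - 1"
    and "\<xi> (n - 1) = \<xi> (n - 2) + 1 \<or> \<xi> (n - 1) = \<xi> (n - 2) - 1"
    and "\<xi> n = \<xi> (n - 2) + 1 \<or> \<xi> n = \<xi> (n - 2) - 1"
proof -
  have *: "\<xi> j = \<xi> i + 1 \<or> \<xi> j = \<xi> i - 1" if "{i, j} \<in> diagram_edges n" for i j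
  proof -
    have "\<bar>\<xi> i - \<xi> j\<bar> = 1" using assms(2) that by (auto simp: admissible_def)
    then show ?thesis by linarith
  qed
  show "\<lbrakk>1 \<le> i; i \<le> n - 2\<rbrakk> \<Longrightarrow> \<xi> (Suc i) = \<xi> i + 1 \<or> \<xi> (Suc i) = \<xi> i - 1"
    by (rule *) (simp add: edge_iff[OF assms(1)])
  show "\<xi> (n - 1) = \<xi> (n - 2) + 1 \<or> \<xi> (n - 1) = \<xi> (n - 2) - 1"
    by (rule *) (use assms(1) in \<open>auto simp: edge_iff\<close>)
  show "\<xi> n = \<xi> (n - 2) + 1 \<or> \<xi> n = \<xi> (n - 2) - 1"
    by (rule *) (use assms(1) in \<open>auto simp: edge_iff\<close>)
qed

lemma peakD:
  assumes "n \<ge> 4" "peak n \<xi> i"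
  shows "\<lbrakk>1 \<le> i; i \<le> n - 2\<rbrakk> \<Longrightarrow> \<xi> (Suc i) = \<xi> i - 1"
    and "\<lbrakk>2 \<le> i; i \<le> n - 1\<rbrakk> \<Longrightarrow> \<xi> (i - 1) = \<xi> i - 1"
    and "i = n - 2 \<Longrightarrow> \<xi> n = \<xi> i - 1"
    and "i = n \<Longrightarrow> \<xi> (n - 2) = \<xi> i - 1"
    and "i = n - 2 \<Longrightarrow> \<xi> (n - 1) = \<xi> i - 1"
proof -
  have *: "\<xi> j = \<xi> i - 1" if "{i, j} \<in> diagram_edges n" for j
    using assms(2) that by (auto simp: peak_def)
  show "\<lbrakk>1 \<le> i; i \<le> n - 2\<rbrakk> \<Longrightarrow> \<xi> (Suc i) = \<xi> i - 1"
    by (rule *) (simp add: edge_iff[OF assms(1)])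
  show "\<lbrakk>2 \<le> i; i \<le> n - 1\<rbrakk> \<Longrightarrow> \<xi> (i - 1) = \<xi> i - 1"
    by (rule *) (use assms(1) in \<open>auto simp: edge_iff\<close>)
  show "i = n - 2 \<Longrightarrow> \<xi> n = \<xi> i - 1"
    by (rule *) (simp add: edge_iff[OF assms(1)])
  show "i = n \<Longrightarrow> \<xi> (n - 2) = \<xi> i - 1"
    by (rule *) (simp add: edge_iff[OF assms(1)])
  show "i = n - 2 \<Longrightarrow> \<xi> (n - 1) = \<xi> i - 1"
    by (rule *) (use assms(1) in \<open>auto simp: edge_iff\<close>)
qed

lemma fire_admissible:
  assumes n: "n \<ge> 4" and adm: "admissible n \<xi>" and pk: "peak n \<xi> i"
  shows "admissible n (fire i \<xi>)"
  unfolding admissible_def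
proof (intro allI impI)
  fix a b
  assume e: "{a, b} \<in> diagram_edges n"
  then have "a \<noteq> b" using n by (auto simp: edge_iff)
  moreover have "a = i \<Longrightarrow> \<xi> b = \<xi> i - 1" using e pk by (auto simp: peak_def)
  moreover have "b = i \<Longrightarrow> \<xi> a = \<xi> i - 1"
    using e pk by (auto simp: peak_def insert_commute)
  moreover have "\<bar>\<xi> a - \<xi> b\<bar> = 1" using e adm by (auto simp: admissible_def)
  ultimately show "\<bar>fire i \<xi> a - fire i \<xi> b\<bar> = 1" by auto
qed

text \<open>Firing one of the two nodes at the fork turns equal heights there into different ones and vice
  versa. The place of the tip stays the same, up to the half period that the node \<open>n\<close> contributes;
  that half period matches the sign in the reflection at \<open>\<alpha>\<^sub>n\<close>.\<close>

lemma tip_flip: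
  assumes n: "n \<ge> 4" and adm: "admissible n \<xi>" and pk: "peak n \<xi> i" and i: "i = n - 1 \<or> i = n"
  shows "tip n (fire i \<xi>) = cotip n \<xi>" "cotip n (fire i \<xi>) = tip n \<xi>"
    and "i = n - 1 \<Longrightarrow> fire i \<xi> (tip n (fire i \<xi>)) = \<xi> (tip n \<xi>)"
    and "i = n \<Longrightarrow> \<xi> (tip n \<xi>) = \<xi> (n - 2) + 1 \<and> fire i \<xi> (tip n (fire i \<xi>)) = \<xi> (n - 2) - 1"
proof -
  have ne: "n - 1 \<noteq> n" using n by linarith
  have b: "\<xi> (n - 1) = \<xi> (n - 2) + 1 \<or> \<xi> (n - 1) = \<xi> (n - 2) - 1"
    and c: "\<xi> n = \<xi> (n - 2) + 1 \<or> \<xi> n = \<xi> (n - 2) - 1"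
    using admissibleD(2,3)[OF n adm] by blast+
  have "n - 1 - 1 = n - 2" by simp
  then have top: "\<xi> i = \<xi> (n - 2) + 1"
    using i peakD(2,4)[OF n pk] n by auto
  have "(fire i \<xi> (n - 1) = fire i \<xi> n) = (\<xi> (n - 1) \<noteq> \<xi> n)"
    using i
  proof
    assume i: "i = n - 1"
    show ?thesis using c top ne unfolding i by (elim disjE) simp_all
  next
    assume i: "i = n"
    show ?thesis using b top ne unfolding i by (elim disjE) simp_all
  qed
  then show "tip n (fire i \<xi>) = cotip n \<xi>" "cotip n (fire i \<xi>) = tip n \<xi>"
    unfolding tip_def cotip_def by presburger+
  note flip = this
  show "fire i \<xi> (tip n (fire i \<xi>)) = \<xi> (tip n \<xi>)" if "i = n - 1"
    unfolding flip using c top ne unfolding that tip_def cotip_def by (elim disjE) simp_all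
  show "\<xi> (tip n \<xi>) = \<xi> (n - 2) + 1 \<and> fire i \<xi> (tip n (fire i \<xi>)) = \<xi> (n - 2) - 1" if "i = n"
    unfolding flip using b top ne unfolding that tip_def cotip_def by (elim disjE) simp_all
qed

lemma tip_cotip: "n \<ge> 4 \<Longrightarrow> tip n \<xi> = n - 1 \<and> cotip n \<xi> = n \<or> tip n \<xi> = n \<and> cotip n \<xi> = n - 1"
  by (simp add: tip_def cotip_def)

lemma slot_chain_low: "x \<le> n - 2 \<Longrightarrow> slot (chain n \<xi>) x = slot \<xi> x"
  by (rule slot_cong) (auto simp: chain_def label_def)

lemma chain_simps:
  assumes "n \<ge> 4"
  shows "x \<le> n - 2 \<Longrightarrow> chain n \<xi> x = \<xi> x"
    and "chain n \<xi> (n - 1) = \<xi> (tip n \<xi>)"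
    and "x \<le> n - 2 \<Longrightarrow> label n \<xi> x = x"
    and "label n \<xi> (n - 1) = tip n \<xi>"
  using assms by (auto simp: chain_def label_def)

lemma slot_chain_top:
  assumes "n \<ge> 4"
  shows "slot (chain n \<xi>) (n - 1) = (if \<xi> (tip n \<xi>) = \<xi> (n - 2) + 1
    then \<xi> (tip n \<xi>) + int n - 1 else \<xi> (tip n \<xi>) - int n + 3)"
proof -
  have "chain n \<xi> (n - 1 - 1) = \<xi> (n - 2)"
    using chain_simps(1)[OF assms, of "n - 2"] by (simp add: numeral_2_eq_2)
  then show ?thesis
    using assms chain_simps(2)[OF assms] unfolding slot_def by auto
qed

lemma chain_height_chain:
  assumes "n \<ge> 4" "admissible n \<xi>"
  shows "height_chain (chain n \<xi>) (n - 1)"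
proof
  fix x assume x: "1 \<le> x" "x < n - 1"
  show "\<bar>chain n \<xi> (Suc x) - chain n \<xi> x\<bar> = 1"
  proof (cases "Suc x \<le> n - 2")
    case True
    then show ?thesis using admissibleD(1)[OF assms, of x] x by (auto simp: chain_simps[OF assms(1)])
  next
    case False
    then have x': "Suc x = n - 1" "x = n - 2" using x by auto
    show ?thesis
      unfolding x'(1) unfolding x'(2)
      using admissibleD(2,3)[OF assms] chain_simps[OF assms(1)] by (auto simp: tip_def)
  qed
qed

section \<open>Source reflections move the placement along\<close>

locale root_frame =
  fixes n :: nat and \<epsilon> :: "nat \<Rightarrow> 'a::real_inner"
  assumes n: "n \<ge> 4" and orth: "orthonormal n \<epsilon>"
begin

abbreviation s :: "nat \<Rightarrow> 'a \<Rightarrow> 'a" where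
  "s \<equiv> simple_reflection n \<epsilon>"

lemma inner_eps:
  "\<lbrakk>i \<in> {1..n}; j \<in> {1..n}\<rbrakk> \<Longrightarrow> \<epsilon> i \<bullet> \<epsilon> j = (if i = j then 1 else 0)"
  using orth by (auto simp: orthonormal_def)

lemma simple_root_norm:
  assumes "i \<in> {1..n}"
  shows "simple_root n \<epsilon> i \<bullet> simple_root n \<epsilon> i = 2"
  using assms n by (auto simp: simple_root_def inner_diff_left inner_diff_right inner_add_left
      inner_add_right inner_eps)

lemma reflection_eq:
  assumes "i \<in> {1..n}"
  shows "s i v = v - (v \<bullet> simple_root n \<epsilon> i) *\<^sub>R simple_root n \<epsilon> i"
  using simple_root_norm[OF assms] by (simp add: simple_reflection_def Let_def)

lemma reflection_eps:
  assumes "1 \<le> i" "i < n" "x \<in> {1..n}"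
  shows "s i (\<epsilon> x) = (if x = i then \<epsilon> (Suc i) else if x = Suc i then \<epsilon> i else \<epsilon> x)"
  using assms by (auto simp: reflection_eq simple_root_def inner_diff_right inner_eps)

lemma reflection_eps_last:
  assumes "x \<in> {1..n}"
  shows "s n (\<epsilon> x) = (if x = n - 1 then - \<epsilon> n else if x = n then - \<epsilon> (n - 1) else \<epsilon> x)"
  using assms n by (auto simp: reflection_eq simple_root_def inner_add_right inner_eps)

lemma reflection_linear: "linear (s i)"
proof (rule linearI)
  fix u v c
  show "s i (u + v) = s i u + s i v"
    by (simp add: simple_reflection_def Let_def inner_add_left distrib_left add_divide_distrib
        scaleR_add_left)
  show "s i (c *\<^sub>R v) = c *\<^sub>R s i v"
    by (simp add: simple_reflection_def Let_def scaleR_diff_right)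
qed

lemma reflection_involution:
  assumes "i \<in> {1..n}"
  shows "s i (s i v) = v"
  using assms simple_root_norm[OF assms] by (simp add: reflection_eq inner_diff_left)

lemma reflection_uminus: "s i (- v) = - s i v"
  using linear_neg[OF reflection_linear] .

text \<open>For \<open>i \<le> n - 2\<close> the reflection exchanges \<open>\<epsilon>\<^sub>i\<close> and \<open>\<epsilon>\<^sub>i\<^sub>+\<^sub>1\<close>, and their slots are exchanged as
  well. For \<open>i \<ge> n - 1\<close> the tip and the cotip are exchanged, and a sign change is compensated by a half
  period.\<close>

lemma placed_reflection:
  assumes adm: "admissible n \<xi>" and i: "i \<in> {1..n}" and pk: "peak n \<xi> i"
    and v: "placed n \<epsilon> \<xi> q v"
  shows "placed n \<epsilon> (fire i \<xi>) q (s i v)"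
proof -
  let ?\<xi> = "fire i \<xi>"
  note cs = chain_simps[OF n] and top = slot_chain_top[OF n]
  \<comment> \<open>The counter \<open>d\<close> records by how many half periods the slot moves.\<close>
  have moved: "\<exists>y\<in>{1..n - 1}. \<exists>d. slot (chain n \<xi>) x = slot (chain n ?\<xi>) y + 2 * int (n - 1) * d \<and>
      s i (\<epsilon> (label n \<xi> x)) = (if even d then \<epsilon> (label n ?\<xi> y) else - \<epsilon> (label n ?\<xi> y))"
    if x: "x \<in> {1..n - 1}" for x
  proof (cases "i \<le> n - 2")
    case low: True
    have eq: "\<xi> (n - 1) = \<xi> n" if "i = n - 2"
      using peakD(3,5)[OF n pk] that by simp
    have "n - 1 \<noteq> i" "n \<noteq> i" using low n by linarith+
    then have tip: "tip n ?\<xi> = tip n \<xi>" by (simp add: tip_def)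
    then have lab: "label n ?\<xi> = label n \<xi>"
      by (simp add: label_def fun_eq_iff)
    have labi: "label n \<xi> i = i" "label n \<xi> (Suc i) = Suc i"
      using low i n eq by (auto simp: label_def tip_def)
    have labx: "label n \<xi> x \<in> {1..n}" "label n \<xi> x = i \<longleftrightarrow> x = i" "label n \<xi> x = Suc i \<longleftrightarrow> x = Suc i"
      using x low i n eq by (auto simp: label_def tip_def)
    have lab_i: "label n \<xi> z = i \<longleftrightarrow> z = i" for z
      using \<open>n - 1 \<noteq> i\<close> \<open>n \<noteq> i\<close> low by (auto simp: label_def tip_def)
    have ch: "chain n ?\<xi> = (chain n \<xi>)(i := chain n \<xi> i - 2)"
      unfolding chain_def lab by (simp add: fun_eq_iff lab_i labi)
    have "slot (chain n ?\<xi>) z =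
        (if z = i then slot (chain n \<xi>) (Suc i) else if z = Suc i then slot (chain n \<xi>) i
         else slot (chain n \<xi>) z)" if "1 \<le> z" for z
      unfolding ch
    proof (rule slot_fire)
      show "1 \<le> i" using i by simp
      show "i = 1 \<or> chain n \<xi> (i - 1) = chain n \<xi> i - 1"
      proof (cases "i = 1")
        case False
        then have "\<xi> (i - 1) = \<xi> i - 1" using peakD(2)[OF n pk] low i by simp
        then show ?thesis using cs(1)[of i] cs(1)[of "i - 1"] low by simp
      qed simp
      show "chain n \<xi> (Suc i) = chain n \<xi> i - 1"
        using peakD(1)[OF n pk] low i labi by (auto simp: chain_def)
      show "1 \<le> z" by fact
    qed
    note sl = this
    have refl: "s i (\<epsilon> (label n \<xi> x)) =
        (if x = i then \<epsilon> (Suc i) else if x = Suc i then \<epsilon> i else \<epsilon> (label n \<xi> x))"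
      using reflection_eps[of i "label n \<xi> x"] labx low i n by auto
    define y where "y = (if x = i then Suc i else if x = Suc i then i else x)"
    have y: "y \<in> {1..n - 1}" using x low i n by (auto simp: y_def)
    show ?thesis
      by (rule bexI[OF _ y], rule exI[of _ 0])
        (use refl sl[of y] y labi in \<open>auto simp: lab y_def\<close>)
  next
    case False
    then have high: "i = n - 1 \<or> i = n" using i by auto
    have s_high: "s (n - 1) (\<epsilon> (n - 1)) = \<epsilon> n" "s (n - 1) (\<epsilon> n) = \<epsilon> (n - 1)"
      "s n (\<epsilon> (n - 1)) = - \<epsilon> n" "s n (\<epsilon> n) = - \<epsilon> (n - 1)"
      using n reflection_eps[of "n - 1" "n - 1"] reflection_eps[of "n - 1" n]
        reflection_eps_last[of "n - 1"] reflection_eps_last[of n] by auto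
    note flip = tip_flip[OF n adm pk high]
    show ?thesis
    proof (cases "x = n - 1")
      case False
      then have x': "x \<le> n - 2" using x by auto
      have "slot (chain n ?\<xi>) x = slot (chain n \<xi>) x"
        unfolding slot_chain_low[OF x'] by (rule slot_cong) (use x' high n in auto)
      moreover have "s i (\<epsilon> x) = \<epsilon> x"
        using high x x' n reflection_eps[of "n - 1" x] reflection_eps_last[of x] by auto
      ultimately show ?thesis
        by (intro bexI[OF _ x] exI[of _ 0]) (simp add: cs x')
    next
      case x1: True
      from high show ?thesis
      proof
        assume i1: "i = n - 1"
        have "?\<xi> (n - 2) = \<xi> (n - 2)" using i1 n by simp
        then have "slot (chain n \<xi>) x = slot (chain n ?\<xi>) x"
          unfolding x1 top using flip(3)[OF i1] by simp
        moreover have "s i (\<epsilon> (label n \<xi> x)) = \<epsilon> (label n ?\<xi> x)"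
          unfolding x1 cs(4) unfolding flip(1) unfolding i1 using tip_cotip[OF n, of \<xi>] s_high by auto
        ultimately show ?thesis by (intro bexI[OF _ x] exI[of _ 0]) simp
      next
        assume i1: "i = n"
        have "?\<xi> (n - 2) = \<xi> (n - 2)" using i1 n by simp
        then have "slot (chain n \<xi>) x = slot (chain n ?\<xi>) x + 2 * int (n - 1) * 1"
          unfolding x1 top using flip(4)[OF i1] n by simp
        moreover have "s i (\<epsilon> (label n \<xi> x)) = - \<epsilon> (label n ?\<xi> x)"
          unfolding x1 cs(4) unfolding flip(1) unfolding i1 using tip_cotip[OF n, of \<xi>] s_high by auto
        ultimately show ?thesis by (intro bexI[OF _ x] exI[of _ 1]) simp
      qed
    qed
  qed
  from v obtain x j where x: "x \<in> {1..n - 1}" and q: "q = slot (chain n \<xi>) x + 2 * int (n - 1) * j"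
    and v': "v = (if even j then \<epsilon> (label n \<xi> x) else - \<epsilon> (label n \<xi> x))"
    unfolding placed_def by blast
  obtain y d where y: "y \<in> {1..n - 1}"
    and sl: "slot (chain n \<xi>) x = slot (chain n ?\<xi>) y + 2 * int (n - 1) * d"
    and sv: "s i (\<epsilon> (label n \<xi> x)) = (if even d then \<epsilon> (label n ?\<xi> y) else - \<epsilon> (label n ?\<xi> y))"
    using moved[OF x] by blast
  show ?thesis
    unfolding placed_def
    by (rule bexI[OF _ y], rule exI[of _ "d + j"])
      (use q v' sl sv in \<open>simp add: reflection_uminus distrib_left\<close>)
qed

text \<open>Only the reflection at \<open>n\<close> produces a sign, so a word in which every node occurs once negates the
  cotip.\<close>

lemma cotip_reflection:
  assumes adm: "admissible n \<xi>" and i: "i \<in> {1..n}" and pk: "peak n \<xi> i"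
  shows "s i (\<epsilon> (cotip n \<xi>)) = (if i = n then - \<epsilon> (cotip n (fire i \<xi>)) else \<epsilon> (cotip n (fire i \<xi>)))"
proof (cases "i \<le> n - 2")
  case True
  have eq: "\<xi> (n - 1) = \<xi> n" if "i = n - 2"
    using peakD(3,5)[OF n pk] that by simp
  have ne: "n - 1 \<noteq> i" "n \<noteq> i" using True n by linarith+
  then have cotip: "cotip n (fire i \<xi>) = cotip n \<xi>" by (simp add: cotip_def)
  have "cotip n \<xi> \<in> {1..n}" "cotip n \<xi> \<noteq> i" using n ne by (auto simp: cotip_def)
  moreover have "cotip n \<xi> \<noteq> Suc i"
  proof (cases "i = n - 2")
    case True
    then show ?thesis using eq n by (simp add: cotip_def)
  next
    case False
    then show ?thesis using True n by (auto simp: cotip_def)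
  qed
  ultimately show ?thesis
    using ne i cotip by (simp add: reflection_eps)
next
  case False
  then have high: "i = n - 1 \<or> i = n" using i by auto
  have "s (n - 1) (\<epsilon> (n - 1)) = \<epsilon> n" "s (n - 1) (\<epsilon> n) = \<epsilon> (n - 1)"
    "s n (\<epsilon> (n - 1)) = - \<epsilon> n" "s n (\<epsilon> n) = - \<epsilon> (n - 1)"
    using n reflection_eps[of "n - 1" "n - 1"] reflection_eps[of "n - 1" n]
      reflection_eps_last[of "n - 1"] reflection_eps_last[of n] by auto
  moreover have "n - 1 \<noteq> n" using n by linarith
  ultimately show ?thesis
    unfolding tip_flip(2)[OF n adm pk high] using high tip_cotip[OF n, of \<xi>] by auto
qed

end

section \<open>The Coxeter element as a shift\<close>

text \<open>The source condition on adapted words, in terms of heights only.\<close>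

primrec firable :: "nat \<Rightarrow> nat list \<Rightarrow> (nat \<Rightarrow> int) \<Rightarrow> bool" where
  "firable n [] \<xi> = True"
| "firable n (i # w) \<xi> = (peak n \<xi> i \<and> firable n w (fire i \<xi>))"

primrec fires :: "nat list \<Rightarrow> (nat \<Rightarrow> int) \<Rightarrow> (nat \<Rightarrow> int)" where
  "fires [] \<xi> = \<xi>"
| "fires (i # w) \<xi> = fires w (fire i \<xi>)"

lemma source_peak:
  assumes "dynkin_quiver n Q" "height_function Q \<xi>" "source_of Q i"
  shows "peak n \<xi> i"
  using assms unfolding dynkin_quiver_def height_function_def source_of_def peak_def by blast

text \<open>Needed to carry the hypotheses on the quiver through the induction along an adapted word.\<close>

lemma reverse_source:
  assumes n: "n \<ge> 4" and dyn: "dynkin_quiver n Q" and ht: "height_function Q \<xi>" and src: "source_of Q i"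
  shows "dynkin_quiver n (reverse_at i Q)" and "height_function (reverse_at i Q) (fire i \<xi>)"
proof -
  have edge: "{a, b} \<in> diagram_edges n" "a \<noteq> b" if "(a, b) \<in> Q" for a b
  proof -
    show "{a, b} \<in> diagram_edges n" using dyn that unfolding dynkin_quiver_def by auto
    then show "a \<noteq> b" using n by (auto simp: edge_iff)
  qed
  have xor: "((a, b) \<in> Q) \<noteq> ((b, a) \<in> Q)" if "{a, b} \<in> diagram_edges n" for a b
    using dyn that unfolding dynkin_quiver_def by blast
  show "dynkin_quiver n (reverse_at i Q)"
    unfolding dynkin_quiver_def
  proof (intro conjI allI impI)
    show "\<forall>(a, b)\<in>reverse_at i Q. {a, b} \<in> diagram_edges n"
      using edge(1) by (fastforce simp: reverse_at_def insert_commute[of i] split: if_splits)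
    show "((a, b) \<in> reverse_at i Q) \<noteq> ((b, a) \<in> reverse_at i Q)"
      if "{a, b} \<in> diagram_edges n" for a b
      using xor[OF that] by (auto simp: reverse_at_def)
  qed
  show "height_function (reverse_at i Q) (fire i \<xi>)"
    unfolding height_function_def
  proof (rule ballI, rule case_prodI2)
    fix e a b assume "e \<in> reverse_at i Q" "e = (a, b)"
    then have ab: "(a, b) \<in> reverse_at i Q" by simp
    show "fire i \<xi> b = fire i \<xi> a - 1"
    proof (cases "a = i \<or> b = i")
      case True
      then have ba: "(b, a) \<in> Q" using ab by (simp add: reverse_at_def)
      then have "a \<noteq> i" using src by (auto simp: source_of_def)
      then have "b = i" "a \<noteq> i" using True by auto
      moreover have "\<xi> a = \<xi> b - 1" using ba ht by (auto simp: height_function_def)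
      ultimately show ?thesis by simp
    next
      case False
      then have "(a, b) \<in> Q" using ab by (simp add: reverse_at_def)
      then have "\<xi> b = \<xi> a - 1" using ht by (auto simp: height_function_def)
      then show ?thesis using False by simp
    qed
  qed
qed

lemma firable_adapted:
  assumes "n \<ge> 4" "dynkin_quiver n Q" "height_function Q \<xi>"
    and "\<forall>k<length w. source_of (fold reverse_at (take k w) Q) (w ! k)"
  shows "firable n w \<xi>"
  using assms(2-4)
proof (induction w arbitrary: Q \<xi>)
  case Nil
  then show ?case by simp
next
  case (Cons i w)
  have src: "source_of Q i" using Cons.prems(3)[rule_format, of 0] by simp
  have "source_of (fold reverse_at (take k w) (reverse_at i Q)) (w ! k)" if "k < length w" for k
    using Cons.prems(3)[rule_format, of "Suc k"] that by simp
  then have "firable n w (fire i \<xi>)"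
    using Cons.IH[of "reverse_at i Q" "fire i \<xi>"]
      reverse_source[OF assms(1) Cons.prems(1,2) src] by blast
  then show ?case using source_peak[OF Cons.prems(1,2) src] by simp
qed

lemma fires_apply:
  "distinct w \<Longrightarrow> fires w \<xi> = (\<lambda>j. if j \<in> set w then \<xi> j - 2 else \<xi> j)"
proof (induction w arbitrary: \<xi>)
  case (Cons i w)
  then show ?case by (auto simp: fun_eq_iff)
qed simp

lemma height_admissible:
  assumes "dynkin_quiver n Q" "height_function Q \<xi>"
  shows "admissible n \<xi>"
proof -
  have "\<xi> j = \<xi> i - 1" if "(i, j) \<in> Q" for i j
    using assms(2) that by (auto simp: height_function_def)
  moreover have "(i, j) \<in> Q \<or> (j, i) \<in> Q" if "{i, j} \<in> diagram_edges n" for i j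
    using assms(1) that unfolding dynkin_quiver_def by blast
  ultimately show ?thesis unfolding admissible_def by fastforce
qed

context root_frame
begin

lemma placed_word:
  assumes "admissible n \<xi>" "firable n w \<xi>" "set w \<subseteq> {1..n}" "placed n \<epsilon> \<xi> q v"
  shows "placed n \<epsilon> (fires w \<xi>) q (fold s w v)"
  using assms
proof (induction w arbitrary: \<xi> v)
  case (Cons i w)
  then show ?case
    using placed_reflection[of \<xi> i q v] fire_admissible[OF n, of \<xi> i] by (simp del: fun_upd_apply)
qed simp

lemma fold_reflection_uminus: "fold s w (- v) = - fold s w v"
  by (induction w arbitrary: v) (simp_all add: reflection_uminus)

lemma cotip_word:
  assumes "admissible n \<xi>" "firable n w \<xi>" "set w \<subseteq> {1..n}" "distinct w"
  shows "fold s w (\<epsilon> (cotip n \<xi>)) =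
    (if n \<in> set w then - \<epsilon> (cotip n (fires w \<xi>))
     else \<epsilon> (cotip n (fires w \<xi>)))"
  using assms
proof (induction w arbitrary: \<xi>)
  case (Cons i w)
  have i: "i \<in> {1..n}" and pk: "peak n \<xi> i" using Cons.prems by auto
  have IH: "fold s w (\<epsilon> (cotip n (fire i \<xi>))) =
    (if n \<in> set w then - \<epsilon> (cotip n (fires w (fire i \<xi>))) else \<epsilon> (cotip n (fires w (fire i \<xi>))))"
    using Cons.IH[OF fire_admissible[OF n Cons.prems(1) pk]] Cons.prems
    by (simp del: fun_upd_apply)
  show ?case
  proof (cases "i = n")
    case True
    then have "n \<notin> set w" using Cons.prems by auto
    then show ?thesis
      using IH cotip_reflection[OF Cons.prems(1) i pk] True
      by (simp add: fold_reflection_uminus del: fun_upd_apply)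
  next
    case False
    then show ?thesis
      using IH cotip_reflection[OF Cons.prems(1) i pk] by (simp del: fun_upd_apply)
  qed
qed simp

text \<open>Lowering all heights by two translates the placement by two.\<close>

lemma placed_fired:
  assumes "placed n \<epsilon> (\<lambda>j. if j \<in> {1..n} then \<xi> j - 2 else \<xi> j) q v"
  shows "placed n \<epsilon> \<xi> (q + 2) v"
proof -
  let ?\<xi> = "\<lambda>j. if j \<in> {1..n} then \<xi> j - 2 else \<xi> j"
  have "n - 1 \<in> {1..n}" "n \<in> {1..n}" using n by auto
  then have tip: "tip n ?\<xi> = tip n \<xi>" by (simp add: tip_def)
  then have lab: "label n ?\<xi> = label n \<xi>" by (simp add: label_def fun_eq_iff)
  have tip_in: "tip n \<xi> \<in> {1..n}" using tip_cotip[OF n, of \<xi>] n by auto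
  have ch: "chain n ?\<xi> x = chain n \<xi> x - 2" if "1 \<le> x" for x
    unfolding chain_def lab using that tip_in n by (auto simp: label_def)
  have "slot (chain n ?\<xi>) x = slot (chain n \<xi>) x - 2" if "1 \<le> x" for x
    using ch[of x] ch[of "x - 1"] that by (cases "x = 1") (simp_all add: slot_def)
  note sl = this
  from assms obtain x j where x: "x \<in> {1..n - 1}"
    and q: "q = slot (chain n ?\<xi>) x + 2 * int (n - 1) * j"
    and v: "v = (if even j then \<epsilon> (label n \<xi> x) else - \<epsilon> (label n \<xi> x))"
    unfolding placed_def lab by blast
  have "q + 2 = slot (chain n \<xi>) x + 2 * int (n - 1) * j"
    unfolding q using sl[of x] x by simp
  then show ?thesis unfolding placed_def using x v by blast
qed

end

locale ar_frame = root_frame n \<epsilon> for n :: nat and \<epsilon> :: "nat \<Rightarrow> 'a::real_inner" +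
  fixes Q :: "(nat \<times> nat) set" and \<xi> :: "nat \<Rightarrow> int" and \<tau> :: "'a \<Rightarrow> 'a"
  assumes dyn: "dynkin_quiver n Q" and ht: "height_function Q \<xi>"
    and cox: "adapted_coxeter n \<epsilon> Q \<tau>"
begin

lemma adm: "admissible n \<xi>"
  using height_admissible[OF dyn ht] .

text \<open>The reflections applied along the word in the order of firing form the inverse of \<open>\<tau>\<close>, so the
  inverse of \<open>\<tau>\<close> moves every vector of the placement two steps up.\<close>

lemma coxeter_facts:
  "\<exists>w. (\<forall>v. \<tau> (fold s w v) = v) \<and> linear \<tau> \<and>
    (\<forall>q v. placed n \<epsilon> \<xi> q v \<longrightarrow> placed n \<epsilon> \<xi> (q + 2) (fold s w v)) \<and>
    fold s w (\<epsilon> (cotip n \<xi>)) = - \<epsilon> (cotip n \<xi>)"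
proof -
  obtain w where aw: "adapted_word n Q w" and tau: "\<tau> = foldr (\<lambda>i f. s i \<circ> f) w id"
    using cox by (auto simp: adapted_coxeter_def)
  have w: "length w = n" "set w = {1..n}"
    and src: "\<forall>k<length w. source_of (fold reverse_at (take k w) Q) (w ! k)"
    using aw by (auto simp: adapted_word_def)
  have dist: "distinct w" using w by (simp add: card_distinct)
  have firable: "firable n w \<xi>" using firable_adapted[OF n dyn ht src] .
  have inv: "foldr (\<lambda>i f. s i \<circ> f) u id (fold s u v) = v" if "set u \<subseteq> {1..n}" for u v
    using that by (induction u arbitrary: v) (simp_all add: reflection_involution)
  have lin: "linear (foldr (\<lambda>i f. s i \<circ> f) u id)" for u
  proof (induction u)
    case (Cons i u)
    show ?case using linear_compose[OF Cons reflection_linear[of i]] by (simp add: comp_def)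
  qed (simp add: linear_id[unfolded id_def])
  have fired: "fires w \<xi> = (\<lambda>j. if j \<in> {1..n} then \<xi> j - 2 else \<xi> j)"
    using fires_apply[OF dist] w(2) by simp
  show ?thesis
  proof (intro exI[of _ w] conjI allI impI)
    show "\<tau> (fold s w v) = v" for v unfolding tau using inv[of w] w(2) by simp
    show "linear \<tau>" unfolding tau by (rule lin)
    show "placed n \<epsilon> \<xi> (q + 2) (fold s w v)" if "placed n \<epsilon> \<xi> q v" for q v
      using placed_fired placed_word[OF adm firable _ that] w(2) fired by simp
    have "n - 1 \<in> {1..n}" "n \<in> {1..n}" using n by auto
    then have "cotip n (fires w \<xi>) = cotip n \<xi>"
      unfolding fired by (simp add: cotip_def)
    then show "fold s w (\<epsilon> (cotip n \<xi>)) = - \<epsilon> (cotip n \<xi>)"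
      using cotip_word[OF adm firable _ dist] w(2) n by simp
  qed
qed

lemma tau_linear: "linear \<tau>"
  using coxeter_facts by blast

lemma tau_cotip: "\<tau> (\<epsilon> (cotip n \<xi>)) = - \<epsilon> (cotip n \<xi>)"
proof -
  obtain w where w: "\<forall>v. \<tau> (fold s w v) = v" "linear \<tau>"
    "\<forall>q v. placed n \<epsilon> \<xi> q v \<longrightarrow> placed n \<epsilon> \<xi> (q + 2) (fold s w v)"
    "fold s w (\<epsilon> (cotip n \<xi>)) = - \<epsilon> (cotip n \<xi>)"
    using coxeter_facts by blast
  have "- \<tau> (\<epsilon> (cotip n \<xi>)) = \<epsilon> (cotip n \<xi>)"
    using w(1)[rule_format, of "\<epsilon> (cotip n \<xi>)"] w(4) linear_neg[OF w(2)] by simp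
  then show ?thesis by (simp add: minus_equation_iff)
qed

lemma tau_placed:
  assumes "placed n \<epsilon> \<xi> q v"
  obtains u where "placed n \<epsilon> \<xi> (q + 2) u" "\<tau> u = v"
proof -
  obtain w where w: "\<forall>v. \<tau> (fold s w v) = v" "linear \<tau>"
    "\<forall>q v. placed n \<epsilon> \<xi> q v \<longrightarrow> placed n \<epsilon> \<xi> (q + 2) (fold s w v)"
    "fold s w (\<epsilon> (cotip n \<xi>)) = - \<epsilon> (cotip n \<xi>)"
    using coxeter_facts by blast
  show ?thesis by (rule that[OF w(3)[rule_format, OF assms] w(1)[rule_format]])
qed

lemma height_chain: "height_chain (chain n \<xi>) (n - 1)"
  using chain_height_chain[OF n adm] .

lemma placed_unique:
  assumes "placed n \<epsilon> \<xi> q v" "placed n \<epsilon> \<xi> q v'"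
  shows "v = v'"
proof -
  obtain x j where x: "x \<in> {1..n - 1}" "q = slot (chain n \<xi>) x + 2 * int (n - 1) * j"
    "v = (if even j then \<epsilon> (label n \<xi> x) else - \<epsilon> (label n \<xi> x))"
    using assms(1) unfolding placed_def by blast
  obtain y k where y: "y \<in> {1..n - 1}" "q = slot (chain n \<xi>) y + 2 * int (n - 1) * k"
    "v' = (if even k then \<epsilon> (label n \<xi> y) else - \<epsilon> (label n \<xi> y))"
    using assms(2) unfolding placed_def by blast
  have "x = y \<and> j = k"
    by (rule height_chain.slot_inj_period[OF height_chain x(1) y(1)]) (use x y in simp)
  then show ?thesis using x(3) y(3) by simp
qed

lemma placed_period:
  assumes "placed n \<epsilon> \<xi> q v"
  shows "placed n \<epsilon> \<xi> (q + 2 * int (n - 1) * m) (if even m then v else - v)"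
proof -
  obtain x j where x: "x \<in> {1..n - 1}" "q = slot (chain n \<xi>) x + 2 * int (n - 1) * j"
    "v = (if even j then \<epsilon> (label n \<xi> x) else - \<epsilon> (label n \<xi> x))"
    using assms(1) unfolding placed_def by blast
  have "q + 2 * int (n - 1) * m = slot (chain n \<xi>) x + 2 * int (n - 1) * (j + m)"
    unfolding x(2) by (simp add: distrib_left)
  moreover have "(if even m then v else - v) =
      (if even (j + m) then \<epsilon> (label n \<xi> x) else - \<epsilon> (label n \<xi> x))"
    unfolding x(3) by simp
  ultimately show ?thesis unfolding placed_def using x(1) by blast
qed

lemma placed_slot:
  assumes "x \<in> {1..n - 1}"
  shows "placed n \<epsilon> \<xi> (slot (chain n \<xi>) x) (\<epsilon> (label n \<xi> x))"
  unfolding placed_def by (rule bexI[OF _ assms], rule exI[of _ 0]) simp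

text \<open>Slots have the parity of \<open>\<xi> 1 + 1\<close>, so only these positions are occupied.\<close>

definition on_grid :: "int \<Rightarrow> bool" where
  "on_grid q \<longleftrightarrow> even (q - \<xi> 1 - 1)"

text \<open>Starting from \<open>\<epsilon>\<^sub>1\<close>, the inverse of the Coxeter element reaches all positions above the slot of \<open>\<epsilon>\<^sub>1\<close>; the others
  are reached by subtracting half periods.\<close>

lemma placed_exists:
  assumes "on_grid q"
  shows "\<exists>v. placed n \<epsilon> \<xi> q v"
proof -
  have up: "\<exists>v. placed n \<epsilon> \<xi> (\<xi> 1 + 1 + 2 * int k) v" for k
  proof (induction k)
    case 0
    have "slot (chain n \<xi>) 1 = \<xi> 1 + 1"
      using n chain_simps(1)[OF n, of 1] by (simp add: slot_def)
    moreover have "1 \<in> {1..n - 1}" using n by simp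
    ultimately show ?case using placed_slot[of 1] by auto
  next
    case (Suc k)
    then obtain v where "placed n \<epsilon> \<xi> (\<xi> 1 + 1 + 2 * int k) v" by blast
    then obtain u where "placed n \<epsilon> \<xi> (\<xi> 1 + 1 + 2 * int k + 2) u" by (rule tau_placed)
    then show ?case by (auto simp: algebra_simps)
  qed
  obtain t where "q - \<xi> 1 - 1 = 2 * t" using assms unfolding on_grid_def by (rule evenE)
  then have t: "q = \<xi> 1 + 1 + 2 * t" by simp
  \<comment> \<open>Adding \<open>\<bar>t\<bar>\<close> half periods is enough to make the offset nonnegative.\<close>
  have "\<bar>t\<bar> * 1 \<le> \<bar>t\<bar> * int (n - 1)" by (rule mult_left_mono) (use n in auto)
  then have "t + int (n - 1) * \<bar>t\<bar> \<ge> 0" by (simp add: mult.commute)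
  then have "int (nat (t + int (n - 1) * \<bar>t\<bar>)) = t + int (n - 1) * \<bar>t\<bar>" by simp
  then obtain v where "placed n \<epsilon> \<xi> (\<xi> 1 + 1 + 2 * (t + int (n - 1) * \<bar>t\<bar>)) v"
    using up[of "nat (t + int (n - 1) * \<bar>t\<bar>)"] by auto
  then have "placed n \<epsilon> \<xi> (\<xi> 1 + 1 + 2 * (t + int (n - 1) * \<bar>t\<bar>) + 2 * int (n - 1) * (- \<bar>t\<bar>))
      (if even (- \<bar>t\<bar>) then v else - v)" by (rule placed_period)
  then show ?thesis unfolding t by (auto simp: algebra_simps)
qed

definition orbit :: "int \<Rightarrow> 'a" where
  "orbit q = (SOME v. placed n \<epsilon> \<xi> q v)"

lemma orbit_placed: "on_grid q \<Longrightarrow> placed n \<epsilon> \<xi> q (orbit q)"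
  unfolding orbit_def using placed_exists by (rule someI_ex)

lemma orbit_eq: "placed n \<epsilon> \<xi> q v \<Longrightarrow> orbit q = v"
  unfolding orbit_def by (rule some_equality) (auto intro: placed_unique)

lemma orbit_tau:
  assumes "on_grid q"
  shows "\<tau> (orbit q) = orbit (q - 2)"
proof -
  have "on_grid (q - 2)" using assms by (simp add: on_grid_def algebra_simps)
  then obtain u where u: "placed n \<epsilon> \<xi> (q - 2 + 2) u" "\<tau> u = orbit (q - 2)"
    using tau_placed[OF orbit_placed] by blast
  then show ?thesis using orbit_eq[of q u] by simp
qed

lemma orbit_antiperiodic:
  assumes "on_grid q"
  shows "orbit (q - 2 * int (n - 1)) = - orbit q"
  using orbit_eq[OF placed_period[OF orbit_placed[OF assms], of "-1"]] by simp

lemma orbit_slot: "x \<in> {1..n - 1} \<Longrightarrow> orbit (slot (chain n \<xi>) x) = \<epsilon> (label n \<xi> x)"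
  by (rule orbit_eq[OF placed_slot])

lemma orbit_expand:
  assumes "on_grid q"
  obtains x j where "x \<in> {1..n - 1}" "q = slot (chain n \<xi>) x + 2 * int (n - 1) * j"
    "orbit q = (if even j then \<epsilon> (label n \<xi> x) else - \<epsilon> (label n \<xi> x))"
  using orbit_placed[OF assms] unfolding placed_def by blast

end

section \<open>The initial roots in terms of the orbit\<close>

context ar_frame
begin

lemma n_facts: "n - 1 - 1 = n - 2" "Suc (n - 2) = n - 1" "n - 1 \<noteq> n" "n - 2 \<noteq> n" "n - 2 \<noteq> n - 1"
  "int (n - 1) = int n - 1" "int (n - 2) = int n - 2" "Suc (n - 1) = n"
  using n by linarith+

lemma xi_height_chain: "height_chain \<xi> (n - 1)"
proof
  fix x assume x: "1 \<le> x" "x < n - 1"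
  then have "x \<le> n - 2" by linarith
  then show "\<bar>\<xi> (Suc x) - \<xi> x\<bar> = 1"
    using admissibleD(1)[OF n adm, of x] x(1) by auto
qed

lemma spin_heights:
  "\<xi> (n - 1) = \<xi> (n - 2) + 1 \<or> \<xi> (n - 1) = \<xi> (n - 2) - 1"
  "\<xi> n = \<xi> (n - 2) + 1 \<or> \<xi> n = \<xi> (n - 2) - 1"
  using admissibleD(2,3)[OF n adm] by blast+

lemma arrow_iff: "(i, j) \<in> Q \<longleftrightarrow> {i, j} \<in> diagram_edges n \<and> \<xi> j = \<xi> i - 1"
proof
  assume ij: "(i, j) \<in> Q"
  have "{i, j} \<in> diagram_edges n" using dyn ij by (auto simp: dynkin_quiver_def)
  moreover have "\<xi> j = \<xi> i - 1" using ht ij by (auto simp: height_function_def)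
  ultimately show "{i, j} \<in> diagram_edges n \<and> \<xi> j = \<xi> i - 1" by simp
next
  assume e: "{i, j} \<in> diagram_edges n \<and> \<xi> j = \<xi> i - 1"
  then have "(i, j) \<in> Q \<or> (j, i) \<in> Q" using dyn unfolding dynkin_quiver_def by blast
  moreover have "(j, i) \<in> Q \<Longrightarrow> \<xi> i = \<xi> j - 1" using ht by (auto simp: height_function_def)
  ultimately show "(i, j) \<in> Q" using e by auto
qed

text \<open>The node \<open>n\<close> has the same distance from the nodes up to \<open>n - 2\<close> as the node \<open>n - 1\<close>.\<close>

definition pos :: "nat \<Rightarrow> int" where
  "pos j = (if j = n then int n - 1 else int j)"

definition graph_dist :: "nat \<Rightarrow> nat \<Rightarrow> int" where
  "graph_dist j i = (if j = n - 1 \<and> i = n \<or> j = n \<and> i = n - 1 then 2 else \<bar>pos j - pos i\<bar>)"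

lemma graph_dist_refl: "graph_dist i i = 0"
  using n_facts(3) by (auto simp: graph_dist_def)

lemma graph_dist_edge:
  assumes "{j, k} \<in> diagram_edges n"
  shows "graph_dist j i \<le> 1 + graph_dist k i"
proof -
  have e: "\<bar>pos j - pos k\<bar> = 1" "j \<in> {n - 1, n} \<Longrightarrow> k = n - 2"
    using assms n unfolding edge_iff[OF n] by (auto simp: pos_def)
  have ge: "\<bar>pos k - pos i\<bar> \<le> graph_dist k i"
    using n by (auto simp: graph_dist_def pos_def)
  show ?thesis
  proof (cases "j = n - 1 \<and> i = n \<or> j = n \<and> i = n - 1")
    case True
    then have "k = n - 2" using e(2) by auto
    then have "graph_dist k i = 1" using True n by (auto simp: graph_dist_def pos_def)
    then show ?thesis using True by (simp add: graph_dist_def)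
  next
    case False
    then have "graph_dist j i = \<bar>pos j - pos i\<bar>" unfolding graph_dist_def by (rule if_not_P)
    then show ?thesis using e(1) ge by linarith
  qed
qed

text \<open>The next node on the shortest walk from \<open>j\<close> to \<open>i\<close>.\<close>

lemma graph_dist_descend:
  assumes "j \<in> {1..n}" "i \<in> {1..n}" "j \<noteq> i"
  obtains k where "k \<in> {1..n}" "{j, k} \<in> diagram_edges n" "graph_dist k i = graph_dist j i - 1"
proof -
  have "\<exists>k. k \<in> {1..n} \<and> {j, k} \<in> diagram_edges n \<and> graph_dist k i = graph_dist j i - 1"
  proof (cases "j \<ge> n - 1")
    case True
    then have j: "j = n - 1 \<or> j = n" using assms(1) by auto
    have "graph_dist (n - 2) i = graph_dist j i - 1"
    proof (cases "i \<ge> n - 1")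
      case True
      then have "i = n - 1 \<or> i = n" using assms(2) by auto
      then show ?thesis using j assms(3) n_facts by (auto simp: graph_dist_def pos_def)
    next
      case False
      then have "int i \<le> int n - 2" "i \<noteq> n" "i \<noteq> n - 1" using n by auto
      then show ?thesis using j n_facts by (auto simp: graph_dist_def pos_def)
    qed
    moreover have "{j, n - 2} \<in> diagram_edges n" using j n by (auto simp: edge_iff[OF n])
    moreover have "n - 2 \<in> {1..n}" using n by auto
    ultimately show ?thesis by blast
  next
    case False
    then have j: "1 \<le> j" "j \<le> n - 2" "j \<noteq> n" "j \<noteq> n - 1" using assms(1) by auto
    show ?thesis
    proof (cases "i < j")
      case True
      then have "graph_dist (j - 1) i = graph_dist j i - 1"
        using j assms by (auto simp: graph_dist_def pos_def)
      moreover have "{j, j - 1} \<in> diagram_edges n" using j True assms(2) by (auto simp: edge_iff[OF n])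
      ultimately show ?thesis using j True assms(2) by (intro exI[of _ "j - 1"]) auto
    next
      case False
      then have "j < i" using assms(3) by simp
      define k where "k = (if j = n - 2 \<and> i = n then n else Suc j)"
      have "graph_dist k i = graph_dist j i - 1"
      proof (cases "j = n - 2 \<and> i = n")
        case True
        moreover have "graph_dist (n - 2) n = 1" using n by (auto simp: graph_dist_def pos_def)
        ultimately show ?thesis by (simp add: k_def graph_dist_refl)
      next
        case False
        then have "\<not> (Suc j = n - 1 \<and> i = n)" "Suc j \<noteq> n" using j by auto
        then show ?thesis using False \<open>j < i\<close> j n by (auto simp: k_def graph_dist_def pos_def)
      qed
      moreover have "{j, k} \<in> diagram_edges n" "k \<in> {1..n}"
        using j n by (auto simp: edge_iff[OF n] k_def)
      ultimately show ?thesis by blast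
    qed
  qed
  then show ?thesis using that by blast
qed

lemma height_lipschitz:
  assumes "j \<in> {1..n}" "i \<in> {1..n}"
  shows "\<xi> j - \<xi> i \<le> graph_dist j i"
  using assms
proof (induction "nat (graph_dist j i)" arbitrary: j rule: less_induct)
  case less
  show ?case
  proof (cases "j = i")
    case True
    then show ?thesis by (simp add: graph_dist_refl)
  next
    case False
    then obtain k where k: "k \<in> {1..n}" "{j, k} \<in> diagram_edges n"
      "graph_dist k i = graph_dist j i - 1"
      using graph_dist_descend less.prems by blast
    have "graph_dist k i \<ge> 0" by (simp add: graph_dist_def)
    then have "\<xi> k - \<xi> i \<le> graph_dist k i" using less.hyps[of k] k less.prems by simp
    moreover have "\<bar>\<xi> j - \<xi> k\<bar> = 1" using adm k(2) by (auto simp: admissible_def)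
    ultimately show ?thesis using k(3) by linarith
  qed
qed

text \<open>Heights drop by one along every arrow and differ by at most the distance, so a path cannot be longer
  than the distance. Conversely, if the height drops by the whole distance, it has to drop at every step
  of a shortest walk, which therefore follows the arrows.\<close>

lemma path_iff:
  assumes "j \<in> {1..n}" "i \<in> {1..n}"
  shows "(j, i) \<in> Q\<^sup>* \<longleftrightarrow> \<xi> j - \<xi> i = graph_dist j i"
proof
  assume "(j, i) \<in> Q\<^sup>*"
  then have "graph_dist j i \<le> \<xi> j - \<xi> i"
  proof (induction rule: converse_rtrancl_induct)
    case base
    then show ?case by (simp add: graph_dist_refl)
  next
    case (step j k)
    then show ?case using graph_dist_edge[of j k i] arrow_iff by auto
  qed
  then show "\<xi> j - \<xi> i = graph_dist j i" using height_lipschitz[OF assms] by simp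
next
  assume "\<xi> j - \<xi> i = graph_dist j i"
  then show "(j, i) \<in> Q\<^sup>*"
    using assms
  proof (induction "nat (graph_dist j i)" arbitrary: j rule: less_induct)
    case less
    show ?case
    proof (cases "j = i")
      case False
      then obtain k where k: "k \<in> {1..n}" "{j, k} \<in> diagram_edges n"
        "graph_dist k i = graph_dist j i - 1"
        using graph_dist_descend less.prems by blast
      have ge: "graph_dist k i \<ge> 0" by (simp add: graph_dist_def)
      have "\<xi> k - \<xi> i \<le> graph_dist k i" using height_lipschitz k(1) less.prems by simp
      moreover have "\<bar>\<xi> j - \<xi> k\<bar> = 1" using adm k(2) by (auto simp: admissible_def)
      ultimately have eq: "\<xi> k = \<xi> j - 1" "\<xi> k - \<xi> i = graph_dist k i"
        using k(3) less.prems(1) by linarith+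
      then have "(k, i) \<in> Q\<^sup>*" using less.hyps[of k] k ge less.prems by simp
      moreover have "(j, k) \<in> Q" using eq(1) k(2) arrow_iff by simp
      ultimately show ?thesis by (rule converse_rtrancl_into_rtrancl[rotated])
    qed simp
  qed
qed

lemma eta_eq:
  assumes "i \<in> {1..n}"
  shows "eta n \<epsilon> Q i = (\<Sum>j | j \<in> {1..n} \<and> \<xi> j - \<xi> i = graph_dist j i. simple_root n \<epsilon> j)"
  unfolding eta_def by (rule sum.cong) (use path_iff[OF _ assms] in auto)

text \<open>The defining property of slots at the nodes up to \<open>n - 2\<close>, in terms of the arrow between \<open>x\<close> and
  \<open>x + 1\<close>. It is used both for computing the initial roots and for identifying the common summand of a
  path at its end.\<close>

lemma orbit_Suc:
  assumes "1 \<le> x" "Suc x \<le> n - 2"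
  shows "\<xi> (Suc x) = \<xi> x + 1 \<and> orbit (\<xi> x + int x + 2) = \<epsilon> (Suc x) \<or>
    \<xi> (Suc x) = \<xi> x - 1 \<and> orbit (\<xi> x - int x) = \<epsilon> (Suc x)"
proof -
  have "orbit (slot \<xi> (Suc x)) = \<epsilon> (Suc x)"
    using orbit_slot[of "Suc x"] assms chain_simps(3)[OF n, of "Suc x"] slot_chain_low[of "Suc x" n \<xi>] by simp
  moreover have "x < n - 1" using assms by simp
  ultimately show ?thesis using height_chain.slot_Suc[OF xi_height_chain assms(1)] by metis
qed

lemma orbit_one: "orbit (\<xi> 1 + 1) = \<epsilon> 1"
proof -
  have one: "1 \<le> n - 2" "1 \<in> {1..n - 1}" using n by auto
  then have "orbit (slot \<xi> 1) = \<epsilon> 1"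
    using orbit_slot[of 1] chain_simps(3)[OF n one(1)] slot_chain_low[OF one(1), of \<xi>] by simp
  then show ?thesis by (simp add: slot_def)
qed

lemma on_grid_add: "on_grid q \<Longrightarrow> on_grid (q + 2 * k)" "on_grid q \<Longrightarrow> on_grid (q - 2 * k)"
  by (simp_all add: on_grid_def)

lemma on_grid_low:
  assumes "1 \<le> i" "i \<le> n - 2"
  shows "on_grid (\<xi> i + int i)" "on_grid (\<xi> i - int i)"
proof -
  have "on_grid (\<xi> i + int i)" using assms
  proof (induction i rule: dec_induct)
    case base
    then show ?case by (simp add: on_grid_def)
  next
    case (step i)
    then have "on_grid (\<xi> i + int i)" by simp
    moreover have "\<xi> (Suc i) = \<xi> i + 1 \<or> \<xi> (Suc i) = \<xi> i - 1"
      using admissibleD(1)[OF n adm, of i] step by auto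
    then have "\<xi> (Suc i) + int (Suc i) = \<xi> i + int i + 2 * 1 \<or>
        \<xi> (Suc i) + int (Suc i) = \<xi> i + int i" by auto
    ultimately show ?case using on_grid_add(1) by metis
  qed
  then show "on_grid (\<xi> i + int i)" "on_grid (\<xi> i - int i)"
    using on_grid_add(2)[of "\<xi> i + int i" "int i"] by auto
qed

lemma on_grid_spin:
  assumes "a = n - 1 \<or> a = n"
  shows "on_grid (\<xi> a + int n - 1)"
proof -
  have eq: "\<xi> (n - 2) + int (n - 2) = \<xi> (n - 2) + int n - 2" and n2: "1 \<le> n - 2" using n by auto
  have "on_grid (\<xi> (n - 2) + int n - 2)"
    using on_grid_low(1)[OF n2 order_refl] by (simp only: eq)
  moreover have "\<xi> a + int n - 1 = \<xi> (n - 2) + int n - 2 + 2 * 1 \<or>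
      \<xi> a + int n - 1 = \<xi> (n - 2) + int n - 2"
    using assms spin_heights by auto
  ultimately show ?thesis using on_grid_add(1) by metis
qed

text \<open>The two ends of the window of \<open>n - 2\<close>, extended by one step, are a half period apart.\<close>

lemma orbit_turn:
  assumes "on_grid (\<xi> (n - 2) - int n + 2)"
  shows "orbit (\<xi> (n - 2) - int n + 2) = - orbit (\<xi> (n - 2) + int n)"
proof -
  have "on_grid (\<xi> (n - 2) + int n)"
    using on_grid_add(1)[OF assms, of "int n - 1"] by (simp add: algebra_simps)
  then show ?thesis using orbit_antiperiodic[of "\<xi> (n - 2) + int n"] n_facts(6)
    by (simp add: algebra_simps)
qed

lemma orbit_top:
  "orbit (\<xi> (n - 2) - int n + 2) =
    (if \<xi> (tip n \<xi>) = \<xi> (n - 2) + 1 then - \<epsilon> (tip n \<xi>) else \<epsilon> (tip n \<xi>))"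
  "orbit (\<xi> (n - 2) + int n) =
    (if \<xi> (tip n \<xi>) = \<xi> (n - 2) + 1 then \<epsilon> (tip n \<xi>) else - \<epsilon> (tip n \<xi>))"
proof -
  have "n - 1 \<in> {1..n - 1}" using n by simp
  then have top: "orbit (slot (chain n \<xi>) (n - 1)) = \<epsilon> (tip n \<xi>)"
    using orbit_slot[of "n - 1"] chain_simps(4)[OF n] by simp
  have tip: "\<xi> (tip n \<xi>) = \<xi> (n - 2) + 1 \<or> \<xi> (tip n \<xi>) = \<xi> (n - 2) - 1"
    using spin_heights by (auto simp: tip_def)
  have eq: "\<xi> (n - 2) - int (n - 2) = \<xi> (n - 2) - int n + 2" and n2: "1 \<le> n - 2" using n by auto
  have "on_grid (\<xi> (n - 2) - int n + 2)"
    using on_grid_low(2)[OF n2 order_refl] by (simp only: eq)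
  note turn = orbit_turn[OF this]
  have "orbit (\<xi> (n - 2) + int n) =
    (if \<xi> (tip n \<xi>) = \<xi> (n - 2) + 1 then \<epsilon> (tip n \<xi>) else - \<epsilon> (tip n \<xi>))"
  proof (cases "\<xi> (tip n \<xi>) = \<xi> (n - 2) + 1")
    case True
    then show ?thesis using top unfolding slot_chain_top[OF n] by simp
  next
    case False
    then have "\<xi> (tip n \<xi>) = \<xi> (n - 2) - 1" using tip by blast
    then have "slot (chain n \<xi>) (n - 1) = \<xi> (n - 2) - int n + 2"
      unfolding slot_chain_top[OF n] by simp
    then have "orbit (\<xi> (n - 2) - int n + 2) = \<epsilon> (tip n \<xi>)"
      using top by simp
    then show ?thesis using turn False by (metis minus_minus)
  qed
  then show "orbit (\<xi> (n - 2) + int n) =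
    (if \<xi> (tip n \<xi>) = \<xi> (n - 2) + 1 then \<epsilon> (tip n \<xi>) else - \<epsilon> (tip n \<xi>))"
    "orbit (\<xi> (n - 2) - int n + 2) =
    (if \<xi> (tip n \<xi>) = \<xi> (n - 2) + 1 then - \<epsilon> (tip n \<xi>) else \<epsilon> (tip n \<xi>))"
    using turn by simp_all
qed

abbreviation \<alpha> :: "nat \<Rightarrow> 'a" where "\<alpha> \<equiv> simple_root n \<epsilon>"

text \<open>The predecessors of \<open>i\<close> on the left of \<open>i\<close> are those on the line \<open>\<xi>\<^sub>j + j = \<xi>\<^sub>i + i\<close>, those on the
  right are on the line \<open>\<xi>\<^sub>j - j = \<xi>\<^sub>i - i\<close>. So \<open>\<eta>\<^sub>i\<close> splits into two telescoping sums, and these compute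
  the two terms of \<open>f (\<xi>\<^sub>i + i) - f (\<xi>\<^sub>i - i)\<close> separately.\<close>

definition left_sum :: "int \<Rightarrow> nat \<Rightarrow> 'a" where
  "left_sum t m = (\<Sum>j | j \<in> {1..<m} \<and> \<xi> j + int j = t. \<alpha> j)"

definition right_sum :: "nat \<Rightarrow> 'a" where
  "right_sum i = (\<Sum>j | j \<in> {i<..n} \<and> \<xi> j - pos j = \<xi> i - int i. \<alpha> j)"

lemma left_sum_Suc:
  assumes "1 \<le> m"
  shows "left_sum t (Suc m) = (if \<xi> m + int m = t then \<alpha> m else 0) + left_sum t m"
proof -
  have "{j. j \<in> {1..<Suc m} \<and> \<xi> j + int j = t} =
     (if \<xi> m + int m = t then insert m else id) {j. j \<in> {1..<m} \<and> \<xi> j + int j = t}"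
    using assms by (auto simp: less_Suc_eq)
  then show ?thesis unfolding left_sum_def by simp
qed

lemma left_sum_high:
  assumes "\<And>j. 1 \<le> j \<Longrightarrow> j < m \<Longrightarrow> \<xi> j + int j < t"
  shows "left_sum t m = 0"
proof -
  have none: "{j. j \<in> {1..<m} \<and> \<xi> j + int j = t} = {}" using assms by fastforce
  show ?thesis unfolding left_sum_def none by simp
qed

text \<open>If \<open>i \<rightarrow> i + 1\<close>, the line through \<open>i + 1\<close> is that through \<open>i\<close> and the sum is extended by
  \<open>\<alpha>\<^sub>i = \<epsilon>\<^sub>i - \<epsilon>\<^sub>i\<^sub>+\<^sub>1\<close>. Otherwise it starts anew, at the slot of \<open>\<epsilon>\<^sub>i\<^sub>+\<^sub>1\<close>.\<close>

lemma left_sum_orbit: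
  assumes "1 \<le> i" "i \<le> n - 2"
  shows "\<epsilon> i + left_sum (\<xi> i + int i) i = orbit (\<xi> i + int i)"
  using assms
proof (induction i rule: dec_induct)
  case base
  then show ?case by (simp add: left_sum_def orbit_one[simplified])
next
  case (step i)
  have i: "1 \<le> i" "Suc i \<le> n - 2" using step by auto
  from orbit_Suc[OF i] show ?case
  proof (elim disjE conjE)
    assume up: "\<xi> (Suc i) = \<xi> i + 1" and o: "orbit (\<xi> i + int i + 2) = \<epsilon> (Suc i)"
    have "\<xi> j + int j \<le> \<xi> i + int i" if "1 \<le> j" "j < Suc i" for j
      using height_chain.window_mono(1)[OF xi_height_chain, of j i] that i by simp
    then have "left_sum (\<xi> (Suc i) + int (Suc i)) (Suc i) = 0"
      using i up by (intro left_sum_high) fastforce+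
    then show ?case using up o by (simp add: algebra_simps)
  next
    assume down: "\<xi> (Suc i) = \<xi> i - 1"
    then have t: "\<xi> (Suc i) + int (Suc i) = \<xi> i + int i" by simp
    have "i \<noteq> n" using i by linarith
    then have "\<epsilon> (Suc i) + \<alpha> i = \<epsilon> i" by (simp add: simple_root_def)
    then show ?case unfolding t left_sum_Suc[OF i(1)] using step.IH i
      by (simp add: add.assoc[symmetric])
  qed
qed

lemma left_sum_spin:
  assumes "a = n - 1 \<or> a = n"
  shows "left_sum (\<xi> a + int n - 1) (n - 1) =
    (if \<xi> a = \<xi> (n - 2) + 1 then 0 else orbit (\<xi> a + int n - 1) - \<epsilon> (n - 1))"
proof (cases "\<xi> a = \<xi> (n - 2) + 1")
  case True
  have "\<xi> j + int j < \<xi> a + int n - 1" if "1 \<le> j" "j < n - 1" for j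
    using height_chain.window_mono(1)[OF xi_height_chain, of j "n - 2"] that n n_facts True by auto
  then have "left_sum (\<xi> a + int n - 1) (n - 1) = 0" by (intro left_sum_high) auto
  then show ?thesis using True by simp
next
  case False
  then have low: "\<xi> a = \<xi> (n - 2) - 1" using spin_heights assms by auto
  have n2: "1 \<le> n - 2" using n by simp
  have t: "\<xi> a + int n - 1 = \<xi> (n - 2) + int (n - 2)" using low n_facts by simp
  have "\<alpha> (n - 2) = \<epsilon> (n - 2) - \<epsilon> (n - 1)"
    using n_facts(2,4) by (simp only: simple_root_def if_False Suc_eq_plus1[symmetric])
  then have "left_sum (\<xi> a + int n - 1) (Suc (n - 2)) = orbit (\<xi> a + int n - 1) - \<epsilon> (n - 1)"
    unfolding t left_sum_Suc[OF n2] left_sum_orbit[OF n2 order_refl, symmetric] by simp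
  then show ?thesis using False n_facts(2) by simp
qed

lemma simple_root_spin: "\<alpha> (n - 1) = \<epsilon> (n - 1) - \<epsilon> n" "\<alpha> n = \<epsilon> (n - 1) + \<epsilon> n"
  using n_facts(3,8) by (simp_all only: simple_root_def if_False if_True Suc_eq_plus1[symmetric] refl)

text \<open>The mirror image of the computation on the left, by induction from \<open>n - 2\<close> downwards. The base
  case distinguishes the four orientations of the two arrows at the fork.\<close>

lemma right_sum_orbit:
  assumes "1 \<le> i" "i \<le> n - 2"
  shows "right_sum i = \<epsilon> (Suc i) - orbit (\<xi> i - int i)"
  using assms(2,1)
proof (induction i rule: inc_induct)
  case base
  have ends: "{n - 2<..n} = {n - 1, n}" using n by auto
  have "{j. j \<in> {n - 2<..n} \<and> \<xi> j - pos j = \<xi> (n - 2) - int (n - 2)} =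
      (if \<xi> (n - 1) = \<xi> (n - 2) + 1 then {n - 1} else {}) \<union>
      (if \<xi> n = \<xi> (n - 2) + 1 then {n} else {})"
    unfolding ends using n_facts by (auto simp: pos_def)
  then have rs: "right_sum (n - 2) = (if \<xi> (n - 1) = \<xi> (n - 2) + 1 then \<alpha> (n - 1) else 0) +
      (if \<xi> n = \<xi> (n - 2) + 1 then \<alpha> n else 0)"
    unfolding right_sum_def using n_facts by simp
  have start: "\<xi> (n - 2) - int (n - 2) = \<xi> (n - 2) - int n + 2" unfolding n_facts(7) by simp
  show ?case
    unfolding rs simple_root_spin n_facts(2) start
    using spin_heights orbit_top(1)
    by (elim disjE) (simp_all add: tip_def)
next
  case (step i)
  have i: "1 \<le> i" "Suc i \<le> n - 2" "i < n" using step n by auto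
  have pos: "pos (Suc i) = int (Suc i)" using i by (auto simp: pos_def)
  have mono: "\<xi> j - pos j \<le> \<xi> (Suc i) - int (Suc i)" if "j \<in> {Suc i<..n}" for j
  proof (cases "j = n")
    case True
    then have "\<xi> j - pos j \<le> \<xi> (n - 2) - int (n - 2)"
      using spin_heights n_facts by (auto simp: pos_def)
    also have "\<dots> \<le> \<xi> (Suc i) - int (Suc i)"
      using height_chain.window_mono(2)[OF xi_height_chain, of "Suc i" "n - 2"] i by simp
    finally show ?thesis .
  next
    case False
    then have "Suc i \<le> j" "j \<le> n - 1" using that by auto
    then show ?thesis
      using height_chain.window_mono(2)[OF xi_height_chain, of "Suc i" j] False by (simp add: pos_def)
  qed
  from orbit_Suc[OF i(1,2)] show ?case
  proof (elim disjE conjE)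
    assume up: "\<xi> (Suc i) = \<xi> i + 1"
    then have t: "\<xi> (Suc i) - int (Suc i) = \<xi> i - int i" by simp
    have "{j. j \<in> {i<..n} \<and> \<xi> j - pos j = \<xi> i - int i} =
        insert (Suc i) {j. j \<in> {Suc i<..n} \<and> \<xi> j - pos j = \<xi> (Suc i) - int (Suc i)}"
      unfolding t using t i pos by (auto simp: Suc_le_eq le_less)
    then have "right_sum i = \<alpha> (Suc i) + right_sum (Suc i)"
      unfolding right_sum_def by simp
    moreover have "right_sum (Suc i) = \<epsilon> (Suc (Suc i)) - orbit (\<xi> i - int i)"
      unfolding t[symmetric] using step.IH i by simp
    moreover have "Suc i \<noteq> n" using i by linarith
    ultimately show ?case by (simp add: simple_root_def)
  next
    assume down: "\<xi> (Suc i) = \<xi> i - 1" and o: "orbit (\<xi> i - int i) = \<epsilon> (Suc i)"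
    have "\<xi> j - pos j \<noteq> \<xi> i - int i" if "j \<in> {i<..n}" for j
    proof (cases "j = Suc i")
      case True
      then show ?thesis using down pos by simp
    next
      case False
      then show ?thesis using mono[of j] that down by simp
    qed
    then have none: "{j. j \<in> {i<..n} \<and> \<xi> j - pos j = \<xi> i - int i} = {}" by blast
    show ?case unfolding right_sum_def none o by simp
  qed
qed

text \<open>The initial root is the difference of two terms of the sequence; applying powers of \<open>\<tau>\<close> then only
  shifts both positions.\<close>

lemma eta_low:
  assumes "1 \<le> i" "i \<le> n - 2"
  shows "eta n \<epsilon> Q i = orbit (\<xi> i + int i) - orbit (\<xi> i - int i)"
proof -
  have i: "i \<in> {1..n}" "i < n - 1" "i \<noteq> n" "i \<noteq> n - 1" using assms n by auto
  let ?L = "{j. j \<in> {1..<i} \<and> \<xi> j + int j = \<xi> i + int i}"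
  let ?R = "{j. j \<in> {i<..n} \<and> \<xi> j - pos j = \<xi> i - int i}"
  have "j \<in> {1..n} \<and> \<xi> j - \<xi> i = graph_dist j i \<longleftrightarrow> j \<in> ?L \<union> insert i ?R" for j
  proof -
    consider "j < i" | "j = i" | "j > i" by linarith
    then show ?thesis
    proof cases
      case 1
      then show ?thesis using i by (auto simp: graph_dist_def pos_def)
    next
      case 2
      then show ?thesis using i by (simp add: graph_dist_refl)
    next
      case 3
      then have "pos j \<ge> int i" using i n_facts by (auto simp: pos_def)
      then have "graph_dist j i = pos j - int i" using i by (auto simp: graph_dist_def pos_def)
      then show ?thesis using 3 i by auto
    qed
  qed
  then have "{j. j \<in> {1..n} \<and> \<xi> j - \<xi> i = graph_dist j i} = ?L \<union> insert i ?R" by blast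
  then have "eta n \<epsilon> Q i = (\<Sum>j \<in> ?L \<union> insert i ?R. \<alpha> j)" unfolding eta_eq[OF i(1)] by simp
  also have "\<dots> = left_sum (\<xi> i + int i) i + (\<alpha> i + right_sum i)"
    unfolding left_sum_def right_sum_def by (subst sum.union_disjoint) auto
  also have "\<alpha> i = \<epsilon> i - \<epsilon> (Suc i)" using i by (simp add: simple_root_def)
  finally show ?thesis
    using left_sum_orbit[OF assms] right_sum_orbit[OF assms] by (simp add: algebra_simps)
qed

text \<open>The multiple of the missing basis vector occurring in \<open>\<eta>\<^sub>n\<^sub>-\<^sub>1\<close> and \<open>\<eta>\<^sub>n\<close>. At a common position of the
  two levels the signs are opposite: for equal heights they are opposite from the start, and for different
  heights one of the levels starts one application of \<open>\<tau>\<close>, hence one sign change, earlier.\<close>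

definition spin_part :: "nat \<Rightarrow> 'a" where
  "spin_part a = (if \<xi> (n - 1) = \<xi> n then (if a = n then \<epsilon> n else - \<epsilon> n) else \<epsilon> (n - 1))"

lemma eta_spin_sum:
  assumes ab: "a = n - 1 \<and> b = n \<or> a = n \<and> b = n - 1"
  shows "eta n \<epsilon> Q a = left_sum (\<xi> a + int n - 1) (n - 1) + \<alpha> a + (if \<xi> b = \<xi> a + 2 then \<alpha> b else 0)"
proof -
  have a: "a \<in> {1..n}" using ab n by auto
  let ?L = "{j. j \<in> {1..<n - 1} \<and> \<xi> j + int j = \<xi> a + int n - 1}"
  let ?R = "if \<xi> b = \<xi> a + 2 then {b} else {}"
  have "j \<in> {1..n} \<and> \<xi> j - \<xi> a = graph_dist j a \<longleftrightarrow> j \<in> ?L \<union> insert a ?R" for j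
  proof -
    have pa: "pos a = int n - 1" using ab n_facts by (auto simp: pos_def)
    consider "j < n - 1" | "j = a" | "j = b" "j \<noteq> a" "j \<ge> n - 1" | "j > n" using ab by linarith
    then show ?thesis
    proof cases
      case 1
      then have "graph_dist j a = int n - 1 - int j"
        using pa ab n_facts by (auto simp: graph_dist_def pos_def)
      moreover have "j \<noteq> a" "j \<noteq> b" using 1 ab n_facts by auto
      ultimately show ?thesis using 1 by auto
    next
      case 2
      then show ?thesis using a by (simp add: graph_dist_refl)
    next
      case 3
      then have "graph_dist j a = 2" using ab by (auto simp: graph_dist_def)
      moreover have "j \<in> {1..n}" using 3 ab n by auto
      ultimately show ?thesis using 3 ab n_facts by auto
    next
      case 4
      then show ?thesis using ab n_facts by auto
    qed
  qed
  then have "{j. j \<in> {1..n} \<and> \<xi> j - \<xi> a = graph_dist j a} = ?L \<union> insert a ?R" by blast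
  then have "eta n \<epsilon> Q a = (\<Sum>j \<in> ?L \<union> insert a ?R. \<alpha> j)" unfolding eta_eq[OF a] by simp
  also have "\<dots> = (\<Sum>j \<in> ?L. \<alpha> j) + (\<Sum>j \<in> insert a ?R. \<alpha> j)"
    by (rule sum.union_disjoint) (use ab n_facts in auto)
  also have "(\<Sum>j \<in> insert a ?R. \<alpha> j) = \<alpha> a + (if \<xi> b = \<xi> a + 2 then \<alpha> b else 0)"
    using ab n_facts by auto
  finally show ?thesis unfolding left_sum_def by (simp add: add.assoc)
qed

text \<open>At the level \<open>a \<in> {n - 1, n}\<close> the root consists of the term of the sequence on the line
  \<open>p + n - 1\<close> and a multiple of the missing basis vector.\<close>

lemma eta_spin:
  assumes a: "a = n - 1 \<or> a = n"
  shows "eta n \<epsilon> Q a = orbit (\<xi> a + int n - 1) + spin_part a"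
proof -
  define b where "b = (if a = n then n - 1 else n)"
  have ab: "a = n - 1 \<and> b = n \<or> a = n \<and> b = n - 1" using a n_facts by (auto simp: b_def)
  note eta = eta_spin_sum[OF ab] and left = left_sum_spin[OF a]
  have ha: "\<xi> a = \<xi> (n - 2) + 1 \<or> \<xi> a = \<xi> (n - 2) - 1" using a spin_heights by auto
  have hb: "\<xi> b = \<xi> (n - 2) + 1 \<or> \<xi> b = \<xi> (n - 2) - 1" using ab spin_heights by auto
  have sum: "\<alpha> a + \<alpha> b = \<epsilon> (n - 1) + \<epsilon> (n - 1)" using ab simple_root_spin by auto
  show ?thesis
  proof (cases "\<xi> a = \<xi> b")
    case True
    then have sp: "\<alpha> a = \<epsilon> (n - 1) + spin_part a" and tip: "tip n \<xi> = n - 1" "\<xi> (n - 1) = \<xi> a"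
      using ab simple_root_spin n_facts by (auto simp: spin_part_def tip_def)
    have "orbit (\<xi> a + int n - 1) = \<epsilon> (n - 1)" if "\<xi> a = \<xi> (n - 2) + 1"
      using orbit_top(2) that tip by simp
    then show ?thesis unfolding eta left sp using True by auto
  next
    case False
    then have sp: "spin_part a = \<epsilon> (n - 1)" "tip n \<xi> = n"
      using ab by (auto simp: spin_part_def tip_def)
    from ha show ?thesis
    proof
      assume hi: "\<xi> a = \<xi> (n - 2) + 1"
      then have lo: "\<xi> b = \<xi> (n - 2) - 1" using hb False by auto
      have "\<alpha> a = orbit (\<xi> (n - 2) + int n) + \<epsilon> (n - 1)"
        using ab hi lo orbit_top(2) simple_root_spin n_facts by (auto simp: sp)
      then show ?thesis unfolding eta left sp using hi lo by (simp add: algebra_simps)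
    next
      assume lo: "\<xi> a = \<xi> (n - 2) - 1"
      then have hi: "\<xi> b = \<xi> (n - 2) + 1" using hb False by auto
      show ?thesis unfolding eta left sp using hi lo sum by (simp add: algebra_simps)
    qed
  qed
qed

lemma tau_spin_part: "\<tau> (spin_part a) = - spin_part a"
  using tau_cotip linear_neg[OF tau_linear]
  by (cases "\<xi> (n - 1) = \<xi> n") (simp_all add: spin_part_def cotip_def)

lemma tau_power_low:
  assumes "1 \<le> i" "i \<le> n - 2"
  shows "(\<tau> ^^ k) (eta n \<epsilon> Q i) = orbit (\<xi> i + int i - 2 * int k) - orbit (\<xi> i - int i - 2 * int k)"
proof (induction k)
  case 0
  then show ?case using eta_low[OF assms] by simp
next
  case (Suc k)
  have "on_grid (\<xi> i + int i - 2 * int k)" "on_grid (\<xi> i - int i - 2 * int k)"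
    using on_grid_low[OF assms] on_grid_add by blast+
  then have "\<tau> ((\<tau> ^^ k) (eta n \<epsilon> Q i)) =
      orbit (\<xi> i + int i - 2 * int k - 2) - orbit (\<xi> i - int i - 2 * int k - 2)"
    unfolding Suc by (simp only: linear_diff[OF tau_linear] orbit_tau)
  then show ?case by (simp add: algebra_simps)
qed

lemma tau_power_spin:
  assumes "a = n - 1 \<or> a = n"
  shows "(\<tau> ^^ k) (eta n \<epsilon> Q a) =
    orbit (\<xi> a + int n - 1 - 2 * int k) + (if even k then spin_part a else - spin_part a)"
proof (induction k)
  case 0
  then show ?case using eta_spin[OF assms] by simp
next
  case (Suc k)
  have "on_grid (\<xi> a + int n - 1 - 2 * int k)"
    using on_grid_spin[OF assms] on_grid_add by blast
  then have "\<tau> ((\<tau> ^^ k) (eta n \<epsilon> Q a)) = orbit (\<xi> a + int n - 1 - 2 * int k - 2) +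
      (if even (Suc k) then spin_part a else - spin_part a)"
    unfolding Suc
    by (simp add: linear_add[OF tau_linear] linear_neg[OF tau_linear] tau_spin_part orbit_tau)
  then show ?case by (simp add: algebra_simps)
qed

end

section \<open>Positivity and the vertices of the quiver\<close>

context root_frame
begin

lemma eps_minus_positive: "\<lbrakk>1 \<le> a; a < b; b \<le> n\<rbrakk> \<Longrightarrow> \<epsilon> a - \<epsilon> b \<in> positive_roots n \<epsilon>"
  unfolding positive_roots_def by blast

lemma eps_plus_positive: "\<lbrakk>1 \<le> a; a < b; b \<le> n\<rbrakk> \<Longrightarrow> \<epsilon> a + \<epsilon> b \<in> positive_roots n \<epsilon>"
  unfolding positive_roots_def by blast

lemma positive_rootE:
  assumes "\<beta> \<in> positive_roots n \<epsilon>"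
  obtains a b where "1 \<le> a" "a < b" "b \<le> n" "\<beta> = \<epsilon> a - \<epsilon> b \<or> \<beta> = \<epsilon> a + \<epsilon> b"
  using assms unfolding positive_roots_def by blast

text \<open>A linear functional that is positive on the positive roots, used to recognise vectors that are not
  positive roots.\<close>

definition weight :: "'a \<Rightarrow> real" where
  "weight v = (\<Sum>i\<in>{1..n}. real (Suc n - i) * (v \<bullet> \<epsilon> i))"

lemma weight_add: "weight (u + v) = weight u + weight v"
  by (simp add: weight_def inner_add_left distrib_left sum.distrib)

lemma weight_minus: "weight (- v) = - weight v"
  by (simp add: weight_def sum_negf)

lemma weight_diff: "weight (u - v) = weight u - weight v"
  using weight_add[of u "- v"] weight_minus[of v] by simp

lemma weight_eps:
  assumes "a \<in> {1..n}"
  shows "weight (\<epsilon> a) = real (Suc n - a)"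
proof -
  have "weight (\<epsilon> a) = (\<Sum>i\<in>{1..n}. if i = a then real (Suc n - a) else 0)"
    unfolding weight_def by (rule sum.cong) (use inner_eps[OF assms] in auto)
  then show ?thesis using assms by simp
qed

lemma weight_positive:
  assumes "\<beta> \<in> positive_roots n \<epsilon>"
  shows "weight \<beta> > 0"
proof -
  obtain a b where ab: "1 \<le> a" "a < b" "b \<le> n" and \<beta>: "\<beta> = \<epsilon> a - \<epsilon> b \<or> \<beta> = \<epsilon> a + \<epsilon> b"
    using positive_rootE[OF assms] by blast
  have "weight (\<epsilon> a) = real (Suc n - a)" "weight (\<epsilon> b) = real (Suc n - b)"
    by (rule weight_eps, use ab in simp)+
  then show ?thesis using \<beta> ab by (auto simp: weight_diff weight_add)
qed

lemma uminus_not_positive: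
  "\<beta> \<in> positive_roots n \<epsilon> \<Longrightarrow> - \<beta> \<notin> positive_roots n \<epsilon>"
  using weight_positive[of \<beta>] weight_positive[of "- \<beta>"] weight_minus[of \<beta>] by fastforce

text \<open>The \<open>k\<close>-th coordinate of the root is negative, and in a positive root only the second of the two basis
  vectors can have a negative sign.\<close>

lemma negative_summand:
  assumes \<beta>: "\<beta> \<in> positive_roots n \<epsilon>" and k: "k \<in> {1..n}" and a: "a \<in> {1..n}"
    and eq: "\<beta> = \<epsilon> a - \<epsilon> k \<or> \<beta> = - \<epsilon> a - \<epsilon> k"
  shows "summand n \<epsilon> (- \<epsilon> k) \<beta>"
proof -
  obtain c d where cd: "1 \<le> c" "c < d" "d \<le> n" and \<beta>': "\<beta> = \<epsilon> c - \<epsilon> d \<or> \<beta> = \<epsilon> c + \<epsilon> d"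
    using positive_rootE[OF \<beta>] by blast
  have "\<beta> \<noteq> 0" using weight_positive[OF \<beta>] by (auto simp: weight_def)
  then have "\<beta> \<bullet> \<epsilon> k < 0"
    using eq inner_eps[OF a k] inner_eps[OF k k] by (auto simp: inner_diff_left)
  moreover have "\<epsilon> c \<bullet> \<epsilon> k \<ge> 0" "\<epsilon> d \<bullet> \<epsilon> k = (if d = k then 1 else 0)"
    using inner_eps[of c k] inner_eps[of d k] cd k by auto
  ultimately have "\<beta> = \<epsilon> c - \<epsilon> d" "d = k"
    using \<beta>' by (auto simp: inner_diff_left inner_add_left split: if_splits)
  then show ?thesis unfolding summand_def using cd by blast
qed

end

context ar_frame
begin

lemma label_range:
  assumes "x \<in> {1..n - 1}"
  shows "label n \<xi> x \<in> {1..n}"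
  using assms tip_cotip[OF n, of \<xi>] n by (auto simp: label_def)

lemma label_less:
  assumes "x < y" "y \<in> {1..n - 1}"
  shows "label n \<xi> x < label n \<xi> y"
proof -
  have "x \<le> n - 2" using assms by auto
  moreover have "tip n \<xi> \<ge> n - 1" using tip_cotip[OF n, of \<xi>] by auto
  then have "y \<le> label n \<xi> y" using assms by (auto simp: label_def)
  ultimately show ?thesis using assms by (simp add: label_def)
qed

lemma orbit_signed:
  assumes "on_grid q"
  obtains a where "a \<in> {1..n}" "orbit q = \<epsilon> a \<or> orbit q = - \<epsilon> a"
  using orbit_expand[OF assms] label_range by (metis (full_types))

text \<open>By \<open>slot_order\<close>, the basis vector of smaller index occurs with a positive sign in the difference.\<close>

lemma low_root_positive:
  assumes i: "1 \<le> i" "i \<le> n - 2" and k: "k \<le> n - 2"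
  shows "orbit (\<xi> i + int i - 2 * int k) - orbit (\<xi> i - int i - 2 * int k) \<in> positive_roots n \<epsilon>"
proof -
  have "on_grid (\<xi> i + int i - 2 * int k)" "on_grid (\<xi> i - int i - 2 * int k)"
    using on_grid_low[OF i] on_grid_add by blast+
  obtain x j where x: "x \<in> {1..n - 1}"
    and P: "\<xi> i + int i - 2 * int k = slot (chain n \<xi>) x + 2 * int (n - 1) * j"
    and oP: "orbit (\<xi> i + int i - 2 * int k) =
      (if even j then \<epsilon> (label n \<xi> x) else - \<epsilon> (label n \<xi> x))"
    using orbit_expand[OF \<open>on_grid (\<xi> i + int i - 2 * int k)\<close>] by blast
  obtain y j' where y: "y \<in> {1..n - 1}"
    and M: "\<xi> i - int i - 2 * int k = slot (chain n \<xi>) y + 2 * int (n - 1) * j'"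
    and oM: "orbit (\<xi> i - int i - 2 * int k) =
      (if even j' then \<epsilon> (label n \<xi> y) else - \<epsilon> (label n \<xi> y))"
    using orbit_expand[OF \<open>on_grid (\<xi> i - int i - 2 * int k)\<close>] by blast
  have "x < y \<and> j = 0 \<or> y < x \<and> j' = - 1"
  proof (rule height_chain.slot_order[OF height_chain i(1) _ _ _ x y])
    show "i < n - 1" using i n by linarith
    show "0 \<le> int k" by simp
    show "int k \<le> int (n - 1) - 1" using k n by linarith
    show "chain n \<xi> i + int i - 2 * int k = slot (chain n \<xi>) x + 2 * int (n - 1) * j"
      using P chain_simps(1)[OF n i(2)] by simp
    show "chain n \<xi> i - int i - 2 * int k = slot (chain n \<xi>) y + 2 * int (n - 1) * j'"
      using M chain_simps(1)[OF n i(2)] by simp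
  qed
  then show ?thesis
  proof
    assume xy: "x < y \<and> j = 0"
    then have "label n \<xi> x < label n \<xi> y" using label_less y by blast
    then show ?thesis
      using oP oM xy label_range[OF x] label_range[OF y]
      by (auto intro: eps_minus_positive eps_plus_positive)
  next
    assume yx: "y < x \<and> j' = - 1"
    then have "label n \<xi> y < label n \<xi> x" using label_less x by blast
    then have "\<epsilon> (label n \<xi> y) + \<epsilon> (label n \<xi> x) \<in> positive_roots n \<epsilon>"
      "\<epsilon> (label n \<xi> y) - \<epsilon> (label n \<xi> x) \<in> positive_roots n \<epsilon>"
      using label_range[OF x] label_range[OF y] by (auto intro: eps_minus_positive eps_plus_positive)
    then show ?thesis
      using oP oM yx by (auto simp: add.commute)
  qed
qed

text \<open>In the window of \<open>z\<close> the sequence has positive signs and indices up to \<open>z\<close>. This decides the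
  positivity of the roots at the levels \<open>n - 1\<close> and \<open>n\<close>.\<close>

lemma window_orbit:
  assumes z: "1 \<le> z" "z \<le> n - 1" and q: "on_grid q"
    and win: "chain n \<xi> z - int z + 2 \<le> q" "q \<le> chain n \<xi> z + int z"
  obtains x where "x \<in> {1..z}" "orbit q = \<epsilon> (label n \<xi> x)"
proof -
  interpret height_chain "chain n \<xi>" "n - 1" by (rule height_chain)
  obtain x j where x: "x \<in> {1..n - 1}" and eq: "q = slot (chain n \<xi>) x + 2 * int (n - 1) * j"
    and o: "orbit q = (if even j then \<epsilon> (label n \<xi> x) else - \<epsilon> (label n \<xi> x))"
    using orbit_expand[OF q] by blast
  have "q - slot (chain n \<xi>) x = 2 * int (n - 1) * j" using eq by simp
  moreover have "\<bar>q - slot (chain n \<xi>) x\<bar> < 2 * int (n - 1)"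
    using slot_inside[of x "n - 1"] x window_mono[of z "n - 1"] z win by auto
  ultimately have j: "j = 0" by (rule small_multiple_of_period)
  then have "x \<le> z" using slot_outside[of z x] z x eq win by (cases "x \<le> z") auto
  then show ?thesis using that[of x] x o j by auto
qed

text \<open>Half a period apart, the terms of the sequence cancel, and two consecutive powers take care of the
  missing basis vector. So four powers of \<open>\<tau>\<close> applied to \<open>\<eta>\<^sub>i\<close> sum to zero. This makes the maximum in the definition of
  \<open>m\<^sub>i\<close> range over a finite set.\<close>

lemma some_power_not_positive:
  assumes "i \<in> {1..n}"
  obtains K where "(\<tau> ^^ K) (eta n \<epsilon> Q i) \<notin> positive_roots n \<epsilon>"
proof -
  have half: "orbit (q - 2 * int (k + (n - 1))) = - orbit (q - 2 * int k)" if "on_grid q" for q k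
    using orbit_antiperiodic[OF on_grid_add(2)[OF that, of "int k"]] by (simp add: algebra_simps)
  let ?\<beta> = "\<lambda>k. (\<tau> ^^ k) (eta n \<epsilon> Q i)"
  have "?\<beta> 0 + ?\<beta> (0 + (n - 1)) + (?\<beta> 1 + ?\<beta> (1 + (n - 1))) = 0"
  proof (cases "i \<le> n - 2")
    case True
    then have i: "1 \<le> i" "i \<le> n - 2" using assms by auto
    show ?thesis
      unfolding tau_power_low[OF i] half[OF on_grid_low(1)[OF i]] half[OF on_grid_low(2)[OF i]] by simp
  next
    case False
    then have i: "i = n - 1 \<or> i = n" using assms by auto
    show ?thesis
      unfolding tau_power_spin[OF i] half[OF on_grid_spin[OF i]] by simp
  qed
  then have "weight (?\<beta> 0) + weight (?\<beta> (0 + (n - 1))) + (weight (?\<beta> 1) + weight (?\<beta> (1 + (n - 1)))) = 0"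
    unfolding weight_add[symmetric] by (simp add: weight_def)
  then have "\<not> (weight (?\<beta> 0) > 0 \<and> weight (?\<beta> (0 + (n - 1))) > 0 \<and>
      weight (?\<beta> 1) > 0 \<and> weight (?\<beta> (1 + (n - 1))) > 0)" by linarith
  then show ?thesis using that weight_positive by blast
qed

abbreviation V :: "(nat \<times> int) set" where
  "V \<equiv> AR_vertices n \<epsilon> Q \<xi> \<tau>"

abbreviation positive_up_to :: "nat \<Rightarrow> nat \<Rightarrow> bool" where
  "positive_up_to i k \<equiv> \<forall>l\<le>k. (\<tau> ^^ l) (eta n \<epsilon> Q i) \<in> positive_roots n \<epsilon>"

lemma finite_positive_up_to:
  assumes "i \<in> {1..n}"
  shows "finite {k. positive_up_to i k}"
proof -
  obtain K where "(\<tau> ^^ K) (eta n \<epsilon> Q i) \<notin> positive_roots n \<epsilon>"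
    using some_power_not_positive[OF assms] by blast
  then have "{k. positive_up_to i k} \<subseteq> {..<K}" by (auto simp: not_less[symmetric])
  then show ?thesis by (rule finite_subset) simp
qed

lemma vertexI:
  assumes "i \<in> {1..n}" "positive_up_to i k" "p = \<xi> i - 2 * int k"
  shows "(i, p) \<in> V"
proof -
  have "k \<le> m_index n \<epsilon> Q \<tau> i"
    unfolding m_index_def by (rule Max_ge) (use finite_positive_up_to[OF assms(1)] assms(2) in auto)
  then show ?thesis unfolding AR_vertices_def using assms(1,3) by blast
qed

lemma vertex_level: "(i, p) \<in> V \<Longrightarrow> i \<in> {1..n}"
  unfolding AR_vertices_def by blast

lemma low_positive_up_to:
  assumes "1 \<le> i" "i \<le> n - 2" "k \<le> n - 2"
  shows "positive_up_to i k"
  using low_root_positive[OF assms(1,2)] assms(3) unfolding tau_power_low[OF assms(1,2)] by auto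

text \<open>Half a period, that is \<open>n - 1\<close> applications of \<open>\<tau>\<close>, turns \<open>\<eta>\<^sub>i\<close> into \<open>- \<eta>\<^sub>i\<close>, and all roots before
  that are positive.\<close>

lemma low_vertex_iff:
  assumes i: "1 \<le> i" "i \<le> n - 2"
  shows "(i, p) \<in> V \<longleftrightarrow> (\<exists>k\<le>n - 2. p = \<xi> i - 2 * int k)"
proof
  assume "(i, p) \<in> V"
  then obtain k where p: "p = \<xi> i - 2 * int k" and k: "k \<le> m_index n \<epsilon> Q \<tau> i" and i': "i \<in> {1..n}"
    unfolding AR_vertices_def by blast
  have "m_index n \<epsilon> Q \<tau> i \<in> {k. positive_up_to i k}"
    unfolding m_index_def
  proof (rule Max_in[OF finite_positive_up_to[OF i']])
    have "positive_up_to i 0" using low_positive_up_to[OF i, of 0] by simp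
    then show "{k. positive_up_to i k} \<noteq> {}" by blast
  qed
  then have pos: "positive_up_to i (m_index n \<epsilon> Q \<tau> i)" by simp
  have "(\<tau> ^^ (n - 1)) (eta n \<epsilon> Q i) = - (\<tau> ^^ 0) (eta n \<epsilon> Q i)"
    unfolding tau_power_low[OF i]
    using orbit_antiperiodic[OF on_grid_low(1)[OF i]] orbit_antiperiodic[OF on_grid_low(2)[OF i]] by simp
  moreover have "(\<tau> ^^ 0) (eta n \<epsilon> Q i) \<in> positive_roots n \<epsilon>" using pos by blast
  ultimately have "(\<tau> ^^ (n - 1)) (eta n \<epsilon> Q i) \<notin> positive_roots n \<epsilon>"
    using uminus_not_positive by simp
  then have "\<not> n - 1 \<le> m_index n \<epsilon> Q \<tau> i" using pos by blast
  then show "\<exists>k\<le>n - 2. p = \<xi> i - 2 * int k" using p k by (intro exI[of _ k]) auto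
next
  assume "\<exists>k\<le>n - 2. p = \<xi> i - 2 * int k"
  then obtain k where k: "k \<le> n - 2" "p = \<xi> i - 2 * int k" by blast
  have "i \<in> {1..n}" using i n by auto
  then show "(i, p) \<in> V" using low_positive_up_to[OF i k(1)] k(2) by (rule vertexI)
qed

lemma spin_part_cotip: "spin_part a = \<epsilon> (cotip n \<xi>) \<or> spin_part a = - \<epsilon> (cotip n \<xi>)"
  by (simp add: spin_part_def cotip_def)

text \<open>For equal heights the missing vector is \<open>\<epsilon> n\<close>, and \<open>\<epsilon>\<^sub>x \<plusminus> \<epsilon>\<^sub>n\<close> is a positive root for every \<open>x < n\<close>.
  So the roots are positive as long as the position is in the window of \<open>n - 1\<close>.\<close>

lemma spin_vertex_equal:
  assumes eq: "\<xi> (n - 1) = \<xi> n" and a: "a = n - 1 \<or> a = n" and k: "k \<le> n - 2"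
  shows "(a, \<xi> a - 2 * int k) \<in> V"
proof (rule vertexI[OF _ _ refl])
  show "a \<in> {1..n}" using a n by auto
  show "positive_up_to a k"
  proof (intro allI impI)
    fix l assume l: "l \<le> k"
    have "on_grid (\<xi> a + int n - 1 - 2 * int l)" using on_grid_spin[OF a] on_grid_add by blast
    moreover have "chain n \<xi> (n - 1) = \<xi> a"
      using chain_simps(2)[OF n] eq a by (auto simp: tip_def)
    then have "chain n \<xi> (n - 1) - int (n - 1) + 2 \<le> \<xi> a + int n - 1 - 2 * int l"
      "\<xi> a + int n - 1 - 2 * int l \<le> chain n \<xi> (n - 1) + int (n - 1)"
      using l k n by linarith+
    moreover have "1 \<le> n - 1" using n by simp
    ultimately obtain x where x: "x \<in> {1..n - 1}"
      and o: "orbit (\<xi> a + int n - 1 - 2 * int l) = \<epsilon> (label n \<xi> x)"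
      using window_orbit[of "n - 1"] by blast
    have lab: "label n \<xi> x \<in> {1..n}" "label n \<xi> x < n"
      using label_range[OF x] x eq n by (auto simp: label_def tip_def)
    have "cotip n \<xi> = n" using eq by (simp add: cotip_def)
    then show "(\<tau> ^^ l) (eta n \<epsilon> Q a) \<in> positive_roots n \<epsilon>"
      unfolding tau_power_spin[OF a] o using spin_part_cotip[of a] lab
        eps_minus_positive[of "label n \<xi> x" n] eps_plus_positive[of "label n \<xi> x" n] by auto
  qed
qed

text \<open>For different heights the missing vector is \<open>\<epsilon> (n - 1)\<close>, and the sequence is certain to contribute
  a positive vector of smaller index only within the window of \<open>n - 2\<close>.\<close>

lemma spin_power_positive:
  assumes ne: "\<xi> (n - 1) \<noteq> \<xi> n" and a: "a = n - 1 \<or> a = n"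
    and q: "\<xi> (n - 2) - int n + 4 \<le> \<xi> a + int n - 1 - 2 * int l"
      "\<xi> a + int n - 1 - 2 * int l \<le> \<xi> (n - 2) + int n - 2"
  shows "(\<tau> ^^ l) (eta n \<epsilon> Q a) \<in> positive_roots n \<epsilon>"
proof -
  have "on_grid (\<xi> a + int n - 1 - 2 * int l)" using on_grid_spin[OF a] on_grid_add by blast
  moreover have "chain n \<xi> (n - 2) = \<xi> (n - 2)" using chain_simps(1)[OF n] by simp
  then have "chain n \<xi> (n - 2) - int (n - 2) + 2 \<le> \<xi> a + int n - 1 - 2 * int l"
    "\<xi> a + int n - 1 - 2 * int l \<le> chain n \<xi> (n - 2) + int (n - 2)"
    using q n_facts(7) by linarith+
  moreover have "1 \<le> n - 2" "n - 2 \<le> n - 1" using n by auto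
  ultimately obtain x where x: "x \<in> {1..n - 2}"
    and o: "orbit (\<xi> a + int n - 1 - 2 * int l) = \<epsilon> (label n \<xi> x)"
    using window_orbit[of "n - 2"] by blast
  have lab: "label n \<xi> x = x" "1 \<le> x" "x < n - 1" "n - 1 \<le> n" using x n by (auto simp: label_def)
  have "cotip n \<xi> = n - 1" using ne by (simp add: cotip_def)
  then show ?thesis
    unfolding tau_power_spin[OF a] o using spin_part_cotip[of a] lab
      eps_minus_positive[of x "n - 1"] eps_plus_positive[of x "n - 1"] by auto
qed

text \<open>On either side of the window of \<open>n - 2\<close> the sequence has \<open>\<plusminus>\<epsilon>\<^sub>n\<close>, and the sign of \<open>\<epsilon>\<^sub>n\<^sub>-\<^sub>1\<close>
  determines whether the root is positive.\<close>

lemma spin_end_positive: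
  assumes ne: "\<xi> (n - 1) \<noteq> \<xi> n" and a: "a = n - 1 \<or> a = n" and l: "even l"
    and q: "\<xi> a + int n - 1 - 2 * int l = \<xi> (n - 2) + int n \<or>
      \<xi> a + int n - 1 - 2 * int l = \<xi> (n - 2) - int n + 2"
  shows "(\<tau> ^^ l) (eta n \<epsilon> Q a) \<in> positive_roots n \<epsilon>"
proof -
  have "tip n \<xi> = n" using ne by (simp add: tip_def)
  then have "orbit (\<xi> (n - 2) + int n) \<in> {\<epsilon> n, - \<epsilon> n}" "orbit (\<xi> (n - 2) - int n + 2) \<in> {\<epsilon> n, - \<epsilon> n}"
    unfolding orbit_top by simp_all
  then have "orbit (\<xi> a + int n - 1 - 2 * int l) = \<epsilon> n \<or> orbit (\<xi> a + int n - 1 - 2 * int l) = - \<epsilon> n"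
    using q by (elim disjE) (simp_all only: insert_iff empty_iff simp_thms)
  moreover have "spin_part a = \<epsilon> (n - 1)" using ne by (simp add: spin_part_def)
  moreover have "\<epsilon> (n - 1) + \<epsilon> n \<in> positive_roots n \<epsilon>" "\<epsilon> (n - 1) - \<epsilon> n \<in> positive_roots n \<epsilon>"
    using n by (auto intro!: eps_minus_positive eps_plus_positive)
  ultimately show ?thesis
    unfolding tau_power_spin[OF a] using l by (auto simp: add.commute)
qed

text \<open>The level with the larger height meets \<open>\<plusminus>\<epsilon>\<^sub>n\<close> at its first position, where the root is the initial one,
  and again \<open>n - 1\<close> steps later, where the sign of \<open>\<epsilon>\<^sub>n\<^sub>-\<^sub>1\<close> depends on the parity of \<open>n\<close>. The level with the
  smaller height meets the latter position one step earlier, with the opposite sign. So one of the two levels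
  has a vertex at that position.\<close>

lemma spin_vertex_high:
  assumes ne: "\<xi> (n - 1) \<noteq> \<xi> n" and a: "a = n - 1 \<or> a = n" and hi: "\<xi> a = \<xi> (n - 2) + 1"
  shows "k \<le> n - 2 \<Longrightarrow> (a, \<xi> a - 2 * int k) \<in> V"
    and "even (n - 1) \<Longrightarrow> (a, \<xi> a - 2 * int (n - 1)) \<in> V"
proof -
  have a': "a \<in> {1..n}" using a n by auto
  have up: "positive_up_to a k" if "k \<le> n - 2" for k
  proof (intro allI impI)
    fix l assume "l \<le> k"
    show "(\<tau> ^^ l) (eta n \<epsilon> Q a) \<in> positive_roots n \<epsilon>"
    proof (cases "l = 0")
      case True
      show ?thesis by (rule spin_end_positive[OF ne a]) (use hi True in auto)
    next
      case False
      have "l \<le> n - 2" using \<open>l \<le> k\<close> that by simp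
      then show ?thesis
        by (intro spin_power_positive[OF ne a]) (use False hi n in linarith)+
    qed
  qed
  then show "k \<le> n - 2 \<Longrightarrow> (a, \<xi> a - 2 * int k) \<in> V" using vertexI[OF a' _ refl] by blast
  assume "even (n - 1)"
  then have last: "(\<tau> ^^ (n - 1)) (eta n \<epsilon> Q a) \<in> positive_roots n \<epsilon>"
    using hi n by (intro spin_end_positive[OF ne a]) auto
  have "positive_up_to a (n - 1)"
  proof (intro allI impI)
    fix l assume "l \<le> n - 1"
    then consider "l = n - 1" | "l \<le> n - 2" by linarith
    then show "(\<tau> ^^ l) (eta n \<epsilon> Q a) \<in> positive_roots n \<epsilon>"
      using last up by cases auto
  qed
  then show "(a, \<xi> a - 2 * int (n - 1)) \<in> V" using vertexI[OF a' _ refl] by blast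
qed

lemma spin_vertex_low:
  assumes ne: "\<xi> (n - 1) \<noteq> \<xi> n" and b: "b = n - 1 \<or> b = n" and lo: "\<xi> b = \<xi> (n - 2) - 1"
  shows "k < n - 2 \<Longrightarrow> (b, \<xi> b - 2 * int k) \<in> V"
    and "odd (n - 1) \<Longrightarrow> (b, \<xi> b - 2 * int (n - 2)) \<in> V"
proof -
  have b': "b \<in> {1..n}" using b n by auto
  have up: "(\<tau> ^^ l) (eta n \<epsilon> Q b) \<in> positive_roots n \<epsilon>" if "l < n - 2" for l
    by (intro spin_power_positive[OF ne b]) (use lo n that in linarith)+
  then show "k < n - 2 \<Longrightarrow> (b, \<xi> b - 2 * int k) \<in> V" using vertexI[OF b' _ refl, of k] by auto
  assume "odd (n - 1)"
  then have "even (n - 2)" using n by auto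
  then have last: "(\<tau> ^^ (n - 2)) (eta n \<epsilon> Q b) \<in> positive_roots n \<epsilon>"
    using lo n by (intro spin_end_positive[OF ne b]) auto
  have "positive_up_to b (n - 2)"
    using last up by (metis le_neq_implies_less)
  then show "(b, \<xi> b - 2 * int (n - 2)) \<in> V" using vertexI[OF b' _ refl] by blast
qed

text \<open>Adjacent levels up to \<open>n - 2\<close> have equally many vertices and are shifted by one against each other.
  So a neighbour can be missing only beyond the first or the last vertex of the level.\<close>

lemma low_neighbour_missing_right:
  assumes "1 \<le> j" "j \<le> n - 2" and adj: "\<xi> j = \<xi> i + 1 \<or> \<xi> j = \<xi> i - 1"
    and k: "k \<le> n - 2" and miss: "(j, \<xi> i - 2 * int k + 1) \<notin> V"
  shows "k = 0 \<and> \<xi> j = \<xi> i - 1"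
proof (rule ccontr)
  assume neg: "\<not> (k = 0 \<and> \<xi> j = \<xi> i - 1)"
  define k' where "k' = (if \<xi> j = \<xi> i + 1 then k else k - 1)"
  have "k' \<le> n - 2" "\<xi> i - 2 * int k + 1 = \<xi> j - 2 * int k'"
    using k adj neg by (auto simp: k'_def)
  then show False using miss low_vertex_iff[OF assms(1,2)] by auto
qed

lemma low_neighbour_missing_left:
  assumes "1 \<le> j" "j \<le> n - 2" and adj: "\<xi> j = \<xi> i + 1 \<or> \<xi> j = \<xi> i - 1"
    and k: "k \<le> n - 2" and miss: "(j, \<xi> i - 2 * int k - 1) \<notin> V"
  shows "k = n - 2 \<and> \<xi> j = \<xi> i + 1"
proof (rule ccontr)
  assume neg: "\<not> (k = n - 2 \<and> \<xi> j = \<xi> i + 1)"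
  define k' where "k' = (if \<xi> j = \<xi> i + 1 then k + 1 else k)"
  have "k' \<le> n - 2" "\<xi> i - 2 * int k - 1 = \<xi> j - 2 * int k'"
    using k adj neg by (auto simp: k'_def)
  then show False using miss low_vertex_iff[OF assms(1,2)] by auto
qed

text \<open>The same at the fork. If the heights of \<open>n - 1\<close> and \<open>n\<close> differ, one of the two neighbours is always
  present; this is why the exceptional value \<open>n - 1\<close> of the index \<open>k\<close> requires two sinks or two sources.\<close>

lemma spin_neighbours_missing_right:
  assumes k: "k \<le> n - 2"
    and miss: "(n - 1, \<xi> (n - 2) - 2 * int k + 1) \<notin> V" "(n, \<xi> (n - 2) - 2 * int k + 1) \<notin> V"
  shows "k = 0 \<and> \<xi> (n - 1) = \<xi> (n - 2) - 1 \<and> \<xi> n = \<xi> (n - 2) - 1"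
proof -
  have missing: "(a, \<xi> (n - 2) - 2 * int k + 1) \<notin> V" if "a = n - 1 \<or> a = n" for a
    using miss that by auto
  have lo: "\<xi> a = \<xi> (n - 2) - 1" if a: "a = n - 1 \<or> a = n" for a
  proof (rule ccontr)
    assume "\<xi> a \<noteq> \<xi> (n - 2) - 1"
    then have hi: "\<xi> a = \<xi> (n - 2) + 1" using a spin_heights by auto
    then have "(a, \<xi> a - 2 * int k) \<in> V"
      using spin_vertex_equal[OF _ a k] spin_vertex_high(1)[OF _ a hi k] by blast
    moreover have "\<xi> a - 2 * int k = \<xi> (n - 2) - 2 * int k + 1" using hi by simp
    ultimately show False using missing[OF a] by simp
  qed
  have "k = 0"
  proof (rule ccontr)
    assume "k \<noteq> 0"
    then have "\<xi> n - 2 * int (k - 1) = \<xi> (n - 2) - 2 * int k + 1" using lo[of n] by auto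
    moreover have "(n, \<xi> n - 2 * int (k - 1)) \<in> V"
      by (rule spin_vertex_equal) (use lo[of n] lo[of "n - 1"] k in auto)
    ultimately show False using miss(2) by simp
  qed
  then show ?thesis using lo by blast
qed

lemma spin_neighbours_missing_left:
  assumes k: "k \<le> n - 2"
    and miss: "(n - 1, \<xi> (n - 2) - 2 * int k - 1) \<notin> V" "(n, \<xi> (n - 2) - 2 * int k - 1) \<notin> V"
  shows "k = n - 2 \<and> \<xi> (n - 1) = \<xi> (n - 2) + 1 \<and> \<xi> n = \<xi> (n - 2) + 1"
proof -
  have missing: "(a, \<xi> (n - 2) - 2 * int k - 1) \<notin> V" if "a = n - 1 \<or> a = n" for a
    using miss that by auto
  have eq: "\<xi> (n - 1) = \<xi> n"
  proof (rule ccontr)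
    assume ne: "\<xi> (n - 1) \<noteq> \<xi> n"
    obtain a b where a: "a = n - 1 \<or> a = n" "\<xi> a = \<xi> (n - 2) + 1"
      and b: "b = n - 1 \<or> b = n" "\<xi> b = \<xi> (n - 2) - 1"
      using ne spin_heights by metis
    have pb: "\<xi> b - 2 * int k = \<xi> (n - 2) - 2 * int k - 1" using b by simp
    have nb: "(b, \<xi> b - 2 * int k) \<notin> V" unfolding pb by (rule missing[OF b(1)])
    then have k2: "k = n - 2"
      using spin_vertex_low(1)[OF ne b, of k] k by linarith
    have pa: "\<xi> a - 2 * int (n - 1) = \<xi> (n - 2) - 2 * int k - 1" using a k2 n by auto
    show False
    proof (cases "even (n - 1)")
      case True
      then show False using spin_vertex_high(2)[OF ne a] missing[OF a(1)] pa by simp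
    next
      case False
      then show False using spin_vertex_low(2)[OF ne b] nb unfolding k2 by simp
    qed
  qed
  have "\<xi> n \<noteq> \<xi> (n - 2) - 1"
  proof
    assume lo: "\<xi> n = \<xi> (n - 2) - 1"
    have "(n, \<xi> n - 2 * int k) \<in> V" by (rule spin_vertex_equal[OF eq]) (use k in auto)
    moreover have "\<xi> n - 2 * int k = \<xi> (n - 2) - 2 * int k - 1" using lo by simp
    ultimately show False using miss(2) by simp
  qed
  then have hi: "\<xi> n = \<xi> (n - 2) + 1" using spin_heights by blast
  have "\<not> k + 1 \<le> n - 2"
  proof
    assume "k + 1 \<le> n - 2"
    then have "(n, \<xi> n - 2 * int (k + 1)) \<in> V" using spin_vertex_equal[OF eq, of n] by blast
    moreover have "\<xi> n - 2 * int (k + 1) = \<xi> (n - 2) - 2 * int k - 1" using hi by simp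
    ultimately show False using miss(2) by simp
  qed
  then show ?thesis using hi eq k by auto
qed

end

section \<open>Shallow maximal paths\<close>

text \<open>Since every arrow raises the second coordinate, prepending or appending a vertex to a path yields a
  path through strictly more vertices.\<close>

lemma maximal_path_ends:
  assumes max: "maximal_path_in W A \<rho>"
    and rise: "\<And>u v. (u, v) \<in> A \<Longrightarrow> snd v = snd u + (1 :: int)"
  shows "v \<in> W \<Longrightarrow> (last \<rho>, v) \<notin> A" and "v \<in> W \<Longrightarrow> (v, hd \<rho>) \<notin> A"
proof -
  have \<rho>: "\<rho> \<noteq> []" "set \<rho> \<subseteq> W" "successively (\<lambda>u v. (u, v) \<in> A) \<rho>"
    using max by (auto simp: maximal_path_in_def path_in_def)
  have bounds: "snd (hd \<sigma>) \<le> snd u \<and> snd u \<le> snd (last \<sigma>)"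
    if "successively (\<lambda>u v. (u, v) \<in> A) \<sigma>" "u \<in> set \<sigma>" for u \<sigma>
    using that
  proof (induction \<sigma> arbitrary: u)
    case (Cons a \<sigma>)
    show ?case
    proof (cases \<sigma>)
      case Nil
      then show ?thesis using Cons.prems by simp
    next
      case (Cons b \<sigma>')
      then have ab: "(a, b) \<in> A" and suc: "successively (\<lambda>u v. (u, v) \<in> A) \<sigma>"
        using Cons.prems(1) by (auto simp: successively_Cons)
      have "snd b \<le> snd v \<and> snd v \<le> snd (last \<sigma>)" if "v \<in> set \<sigma>" for v
        using Cons.IH[OF suc that] Cons by simp
      moreover have "snd b = snd a + 1" using rise[OF ab] .
      moreover have "b \<in> set \<sigma>" "last (a # \<sigma>) = last \<sigma>" using Cons by auto
      ultimately have "snd a \<le> snd (last (a # \<sigma>))" "\<And>v. v \<in> set \<sigma> \<Longrightarrow> snd a \<le> snd v \<and> snd v \<le> snd (last (a # \<sigma>))"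
        by fastforce+
      then show ?thesis using Cons.prems(2) unfolding list.sel(1) set_simps insert_iff by blast
    qed
  qed simp
  show "(last \<rho>, v) \<notin> A" if v: "v \<in> W"
  proof
    assume a: "(last \<rho>, v) \<in> A"
    then have "v \<notin> set \<rho>" using rise[OF a] bounds[OF \<rho>(3), of v] by auto
    moreover have "path_in W A (\<rho> @ [v])"
      using \<rho> v a by (auto simp: path_in_def successively_append_iff)
    moreover have "set \<rho> \<subset> set (\<rho> @ [v])" using \<open>v \<notin> set \<rho>\<close> by auto
    ultimately show False using max unfolding maximal_path_in_def by blast
  qed
  show "(v, hd \<rho>) \<notin> A" if v: "v \<in> W"
  proof
    assume a: "(v, hd \<rho>) \<in> A"
    then have "v \<notin> set \<rho>" using rise[OF a] bounds[OF \<rho>(3), of v] by auto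
    moreover have "path_in W A (v # \<rho>)"
      using \<rho> v a by (auto simp: path_in_def successively_Cons)
    moreover have "set \<rho> \<subset> set (v # \<rho>)" using \<open>v \<notin> set \<rho>\<close> by auto
    ultimately show False using max unfolding maximal_path_in_def by blast
  qed
qed

context ar_frame
begin

abbreviation S_edges where "S_edges \<equiv> S_arrows n \<epsilon> Q \<xi> \<tau>"
abbreviation N_edges where "N_edges \<equiv> N_arrows n \<epsilon> Q \<xi> \<tau>"

lemma S_arrow_iff:
  "((i, p), (j, r)) \<in> S_edges \<longleftrightarrow> (i, p) \<in> V \<and> (j, r) \<in> V \<and> r = p + 1 \<and>
    (1 \<le> i \<and> i \<le> n - 2 \<and> j = Suc i \<or> i = n - 2 \<and> j = n)"
  unfolding S_arrows_def AR_arrows_def by (auto simp: edge_iff[OF n])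

lemma N_arrow_iff:
  "((i, p), (j, r)) \<in> N_edges \<longleftrightarrow> (i, p) \<in> V \<and> (j, r) \<in> V \<and> r = p + 1 \<and>
    (1 \<le> j \<and> j \<le> n - 2 \<and> i = Suc j \<or> j = n - 2 \<and> i = n)"
proof -
  have "((i, p), (j, r)) \<in> N_edges \<longleftrightarrow> (i, p) \<in> V \<and> (j, r) \<in> V \<and> r = p + 1 \<and>
      {i, j} \<in> diagram_edges n \<and> (2 \<le> i \<and> i \<le> n - 1 \<and> j = i - 1 \<or> i = n \<and> j = n - 2)"
    unfolding N_arrows_def AR_arrows_def by auto
  also have "{i, j} \<in> diagram_edges n \<and> (2 \<le> i \<and> i \<le> n - 1 \<and> j = i - 1 \<or> i = n \<and> j = n - 2) \<longleftrightarrow>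
      (1 \<le> j \<and> j \<le> n - 2 \<and> i = Suc j \<or> j = n - 2 \<and> i = n)"
    using n unfolding edge_iff[OF n] by auto
  finally show ?thesis .
qed

lemma S_arrow_rise: "(u, v) \<in> S_edges \<Longrightarrow> snd v = snd u + 1"
  using S_arrow_iff by (cases u; cases v) auto

lemma N_arrow_rise: "(u, v) \<in> N_edges \<Longrightarrow> snd v = snd u + 1"
  using N_arrow_iff by (cases u; cases v) auto

text \<open>Levels increase along the path, so it avoids the fork if its last level is at most \<open>n - 2\<close>.\<close>

lemma S_path_line:
  assumes "successively (\<lambda>u v. (u, v) \<in> S_edges) \<rho>" "set \<rho> \<subseteq> V" "\<rho> \<noteq> []"
    and "fst (last \<rho>) \<le> n - 2" "v \<in> set \<rho>"
  shows "1 \<le> fst v \<and> fst v \<le> fst (last \<rho>) \<and> snd v - int (fst v) = snd (last \<rho>) - int (fst (last \<rho>))"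
  using assms
proof (induction \<rho> arbitrary: v)
  case (Cons a \<rho>)
  have "a \<in> V" using Cons.prems by simp
  then have a1: "1 \<le> fst a" using vertex_level[of "fst a" "snd a"] by simp
  show ?case
  proof (cases "\<rho> = []")
    case True
    then show ?thesis using Cons.prems a1 by simp
  next
    case False
    then have arr: "(a, hd \<rho>) \<in> S_edges" and suc: "successively (\<lambda>u v. (u, v) \<in> S_edges) \<rho>"
      using Cons.prems(1) by (auto simp: successively_Cons)
    have IH: "1 \<le> fst u \<and> fst u \<le> fst (last \<rho>) \<and>
        snd u - int (fst u) = snd (last \<rho>) - int (fst (last \<rho>))" if "u \<in> set \<rho>" for u
      using Cons.IH[OF suc _ False _ that] Cons.prems False by simp
    obtain i p j r where ij: "a = (i, p)" "hd \<rho> = (j, r)" by (metis surj_pair)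
    have hd: "hd \<rho> \<in> set \<rho>" using False by simp
    then have "j \<le> n - 2" using IH[OF hd] ij Cons.prems(4) False by simp
    then have "j = Suc i \<and> r = p + 1"
      using arr n unfolding ij S_arrow_iff by auto
    then have a: "1 \<le> fst a \<and> fst a \<le> fst (last \<rho>) \<and>
        snd a - int (fst a) = snd (last \<rho>) - int (fst (last \<rho>))"
      using IH[OF hd] ij a1 by auto
    have "v = a \<or> v \<in> set \<rho>" using Cons.prems(5) by simp
    moreover have "last (a # \<rho>) = last \<rho>" using False by simp
    ultimately show ?thesis using a IH[of v] by metis
  qed
qed simp

lemma N_path_line:
  assumes "successively (\<lambda>u v. (u, v) \<in> N_edges) \<rho>" "set \<rho> \<subseteq> V" "\<rho> \<noteq> []"
    and "fst (hd \<rho>) \<le> n - 2" "v \<in> set \<rho>"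
  shows "1 \<le> fst v \<and> fst v \<le> fst (hd \<rho>) \<and> snd v + int (fst v) = snd (hd \<rho>) + int (fst (hd \<rho>))"
  using assms
proof (induction \<rho> arbitrary: v)
  case (Cons a \<rho>)
  have "a \<in> V" using Cons.prems by simp
  then have a1: "1 \<le> fst a" using vertex_level[of "fst a" "snd a"] by simp
  show ?case
  proof (cases "\<rho> = []")
    case True
    then show ?thesis using Cons.prems a1 by simp
  next
    case False
    then have arr: "(a, hd \<rho>) \<in> N_edges" and suc: "successively (\<lambda>u v. (u, v) \<in> N_edges) \<rho>"
      using Cons.prems(1) by (auto simp: successively_Cons)
    obtain i p j r where ij: "a = (i, p)" "hd \<rho> = (j, r)" by (metis surj_pair)
    have "i \<le> n - 2" using Cons.prems(4) ij by simp
    then have step: "i = Suc j \<and> r = p + 1"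
      using arr n unfolding ij N_arrow_iff by auto
    then have low: "fst (hd \<rho>) \<le> n - 2" using ij \<open>i \<le> n - 2\<close> by simp
    show ?thesis
    proof (cases "v = a")
      case True
      then show ?thesis using a1 by simp
    next
      case False
      then have "v \<in> set \<rho>" using Cons.prems(5) by simp
      then show ?thesis
        using Cons.IH[OF suc _ \<open>\<rho> \<noteq> []\<close> low, of v] Cons.prems(2) step ij by simp
    qed
  qed
qed simp

lemma AR_root_low:
  assumes "1 \<le> i" "i \<le> n - 2" "(i, p) \<in> V"
  shows "AR_root n \<epsilon> Q \<xi> \<tau> (i, p) = orbit (p + int i) - orbit (p - int i)"
    and "AR_root n \<epsilon> Q \<xi> \<tau> (i, p) \<in> positive_roots n \<epsilon>"
    and "on_grid (p + int i)" "on_grid (p - int i)"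
proof -
  obtain k where k: "k \<le> n - 2" "p = \<xi> i - 2 * int k"
    using assms(3) unfolding low_vertex_iff[OF assms(1,2)] by blast
  have "AR_root n \<epsilon> Q \<xi> \<tau> (i, p) = (\<tau> ^^ k) (eta n \<epsilon> Q i)"
    unfolding AR_root_def using k(2) by simp
  also have "\<dots> = orbit (\<xi> i + int i - 2 * int k) - orbit (\<xi> i - int i - 2 * int k)"
    by (rule tau_power_low[OF assms(1,2)])
  finally have root: "AR_root n \<epsilon> Q \<xi> \<tau> (i, p) =
      orbit (\<xi> i + int i - 2 * int k) - orbit (\<xi> i - int i - 2 * int k)" .
  have p: "p + int i = \<xi> i + int i - 2 * int k" "p - int i = \<xi> i - int i - 2 * int k"
    using k(2) by auto
  show "AR_root n \<epsilon> Q \<xi> \<tau> (i, p) = orbit (p + int i) - orbit (p - int i)"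
    unfolding p by (rule root)
  show "AR_root n \<epsilon> Q \<xi> \<tau> (i, p) \<in> positive_roots n \<epsilon>"
    unfolding root by (rule low_root_positive[OF assms(1,2) k(1)])
  show "on_grid (p + int i)" "on_grid (p - int i)"
    unfolding p using on_grid_low[OF assms(1,2)] on_grid_add(2) by blast+
qed

lemma low_neighbour_heights:
  "\<lbrakk>1 \<le> i; Suc i \<le> n - 2\<rbrakk> \<Longrightarrow> \<xi> (Suc i) = \<xi> i + 1 \<or> \<xi> (Suc i) = \<xi> i - 1"
  using admissibleD(1)[OF n adm, of i] by simp

lemma spin_delta:
  assumes "\<xi> (n - 1) = \<xi> (n - 2) - 1 \<and> \<xi> n = \<xi> (n - 2) - 1 \<or>
    \<xi> (n - 1) = \<xi> (n - 2) + 1 \<and> \<xi> n = \<xi> (n - 2) + 1"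
  shows "delta n Q = 1"
proof -
  have "{a, j} \<in> diagram_edges n \<longleftrightarrow> j = n - 2" if "a = n - 1 \<or> a = n" for a j
    using that n unfolding edge_iff[OF n] by auto
  then have out: "(a, j) \<in> Q \<Longrightarrow> \<xi> (n - 2) = \<xi> a - 1"
    and into: "(j, a) \<in> Q \<Longrightarrow> \<xi> a = \<xi> (n - 2) - 1" if "a = n - 1 \<or> a = n" for a j
    using that unfolding arrow_iff by (auto simp: insert_commute)
  from assms have "sink_of Q (n - 1) \<and> sink_of Q n \<or> source_of Q (n - 1) \<and> source_of Q n"
  proof
    assume lo: "\<xi> (n - 1) = \<xi> (n - 2) - 1 \<and> \<xi> n = \<xi> (n - 2) - 1"
    have "(n - 1, j) \<notin> Q" "(n, j) \<notin> Q" for j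
      using lo out[of "n - 1" j] out[of n j] by linarith+
    then show ?thesis by (simp add: sink_of_def)
  next
    assume hi: "\<xi> (n - 1) = \<xi> (n - 2) + 1 \<and> \<xi> n = \<xi> (n - 2) + 1"
    have "(j, n - 1) \<notin> Q" "(j, n) \<notin> Q" for j
      using hi into[of "n - 1" j] into[of n j] by linarith+
    then show ?thesis by (simp add: source_of_def)
  qed
  then show ?thesis by (simp add: delta_def)
qed

text \<open>The last vertex is \<open>(i, \<xi>\<^sub>i)\<close> with \<open>f (\<xi>\<^sub>i - i) = \<epsilon>\<^sub>i\<^sub>+\<^sub>1\<close>, and \<open>- \<epsilon>\<^sub>i\<^sub>+\<^sub>1\<close> is the summand common to all
  roots on the path.\<close>

lemma shallow_S:
  assumes "shallow_maximal_S_path n \<epsilon> Q \<xi> \<tau> \<rho>"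
  shows "(\<exists>k. 1 \<le> k \<and> k \<le> n - 2 + delta n Q \<and>
      (\<forall>v\<in>set \<rho>. summand n \<epsilon> (- \<epsilon> k) (AR_root n \<epsilon> Q \<xi> \<tau> v))) \<and> level (hd \<rho>) = 1"
proof -
  have max: "maximal_path_in V S_edges \<rho>" and "level (last \<rho>) < n - 1"
    using assms by (auto simp: shallow_maximal_S_path_def)
  then have low: "fst (last \<rho>) \<le> n - 2" by (simp add: level_def)
  have \<rho>: "\<rho> \<noteq> []" "set \<rho> \<subseteq> V" "successively (\<lambda>u v. (u, v) \<in> S_edges) \<rho>"
    using max by (auto simp: maximal_path_in_def path_in_def)
  obtain i p where last: "last \<rho> = (i, p)" by fastforce
  have lastV: "(i, p) \<in> V" using \<rho> last by (metis last_in_set subsetD)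
  have i: "1 \<le> i" "i \<le> n - 2" using vertex_level[OF lastV] low last by auto
  have line: "1 \<le> fst v \<and> fst v \<le> i \<and> snd v - int (fst v) = p - int i" if "v \<in> set \<rho>" for v
    using S_path_line[OF \<rho>(3,2,1) low that] last by simp
  obtain k where k: "k \<le> n - 2" "p = \<xi> i - 2 * int k"
    using lastV unfolding low_vertex_iff[OF i] by blast
  have noext: "(j, p + 1) \<notin> V" if "j = Suc i \<or> i = n - 2 \<and> j = n" for j
    using maximal_path_ends(1)[OF max S_arrow_rise, of "(j, p + 1)"] that i lastV
    unfolding last S_arrow_iff by auto
  have fin: "k = 0 \<and> orbit (p - int i) = \<epsilon> (Suc i) \<and> Suc i \<le> n - 2 + delta n Q"
  proof (cases "i = n - 2")
    case False
    then have i': "1 \<le> Suc i" "Suc i \<le> n - 2" using i by auto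
    have "k = 0 \<and> \<xi> (Suc i) = \<xi> i - 1"
      by (rule low_neighbour_missing_right[OF i' low_neighbour_heights[OF i(1) i'(2)] k(1)])
        (use noext[of "Suc i"] k(2) in simp)
    then show ?thesis using orbit_Suc[OF i(1) i'(2)] k(2) i' by auto
  next
    case True
    have stop: "k = 0 \<and> \<xi> (n - 1) = \<xi> (n - 2) - 1 \<and> \<xi> n = \<xi> (n - 2) - 1"
      by (rule spin_neighbours_missing_right[OF k(1)])
        (use noext[of "n - 1"] noext[of n] k(2) True n_facts in auto)
    then have "p - int i = \<xi> (n - 2) - int n + 2" "tip n \<xi> = n - 1" "Suc i = n - 1"
      using k(2) True n_facts by (auto simp: tip_def)
    then show ?thesis using orbit_top(1) stop spin_delta by simp
  qed
  have sum: "summand n \<epsilon> (- \<epsilon> (Suc i)) (AR_root n \<epsilon> Q \<xi> \<tau> v)" if v: "v \<in> set \<rho>" for v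
  proof -
    obtain j r where jr: "v = (j, r)" by fastforce
    have j: "1 \<le> j" "j \<le> n - 2" "r - int j = p - int i" using line[OF v] i jr by auto
    have jV: "(j, r) \<in> V" using v \<rho>(2) jr by blast
    note root = AR_root_low[OF j(1,2) jV]
    obtain a where a: "a \<in> {1..n}" "orbit (r + int j) = \<epsilon> a \<or> orbit (r + int j) = - \<epsilon> a"
      using orbit_signed[OF root(3)] by blast
    have "Suc i \<in> {1..n}" using i n by auto
    then show ?thesis unfolding jr
      by (rule negative_summand[OF root(2) _ a(1)]) (use root(1) a(2) j(3) fin in auto)
  qed
  obtain j r where hd: "hd \<rho> = (j, r)" by fastforce
  have hdV: "(j, r) \<in> V" and hdS: "(j, r) \<in> set \<rho>" using \<rho> hd by (metis hd_in_set subsetD)+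
  have j: "1 \<le> j" "j \<le> i" "r - int j = p - int i" using line[OF hdS] by auto
  have j2: "j \<le> n - 2" using j(2) i by simp
  have "j = 1"
  proof (rule ccontr)
    assume "j \<noteq> 1"
    then obtain m where m: "j = Suc m" "1 \<le> m" using j(1) by (cases j) auto
    have mn: "m \<le> n - 2" "Suc m \<le> n - 2" using m j2 by auto
    \<comment> \<open>If the path began at a level \<open>j > 1\<close>, then \<open>(j, r)\<close> would be the last vertex of its level on the
      left, and the path would have to rise by at least \<open>n - 2\<close> levels to get to the right end of a level.\<close>
    have "(m, r - 1) \<notin> V"
      using maximal_path_ends(2)[OF max S_arrow_rise, of "(m, r - 1)"] m mn hdV
      unfolding hd S_arrow_iff by auto
    moreover obtain l where l: "l \<le> n - 2" "r = \<xi> j - 2 * int l"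
      using hdV unfolding low_vertex_iff[OF j(1) j2] by blast
    moreover have "\<xi> m = \<xi> j + 1 \<or> \<xi> m = \<xi> j - 1"
      using low_neighbour_heights[OF m(2) mn(2)] m(1) by auto
    ultimately have "l = n - 2"
      using low_neighbour_missing_left[OF m(2) mn(1), of j l] by simp
    moreover have "\<xi> j - int j \<ge> \<xi> i - int i" "\<xi> j + int j \<le> \<xi> i + int i"
      using height_chain.window_mono[OF xi_height_chain, of j i] j i by auto
    moreover have "p = \<xi> i" using fin k(2) by simp
    ultimately show False using j l(2) i m n by linarith
  qed
  then have "level (hd \<rho>) = 1" using hd by (simp add: level_def)
  then show ?thesis using fin sum by (intro conjI exI[of _ "Suc i"]) simp_all
qed

text \<open>The first vertex is \<open>(i, \<xi>\<^sub>i - 2 (n - 2))\<close> with \<open>f (p + i) = - \<epsilon>\<^sub>i\<^sub>+\<^sub>1\<close>, and this is the summand common to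
  all roots on the path.\<close>

lemma shallow_N:
  assumes "shallow_maximal_N_path n \<epsilon> Q \<xi> \<tau> \<rho>"
  shows "(\<exists>k. 1 \<le> k \<and> k \<le> n - 2 + delta n Q \<and>
      (\<forall>v\<in>set \<rho>. summand n \<epsilon> (- \<epsilon> k) (AR_root n \<epsilon> Q \<xi> \<tau> v))) \<and> level (last \<rho>) = 1"
proof -
  have max: "maximal_path_in V N_edges \<rho>" and "level (hd \<rho>) < n - 1"
    using assms by (auto simp: shallow_maximal_N_path_def)
  then have low: "fst (hd \<rho>) \<le> n - 2" by (simp add: level_def)
  have \<rho>: "\<rho> \<noteq> []" "set \<rho> \<subseteq> V" "successively (\<lambda>u v. (u, v) \<in> N_edges) \<rho>"
    using max by (auto simp: maximal_path_in_def path_in_def)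
  obtain i p where hd: "hd \<rho> = (i, p)" by fastforce
  have hdV: "(i, p) \<in> V" using \<rho> hd by (metis hd_in_set subsetD)
  have i: "1 \<le> i" "i \<le> n - 2" using vertex_level[OF hdV] low hd by auto
  have line: "1 \<le> fst v \<and> fst v \<le> i \<and> snd v + int (fst v) = p + int i" if "v \<in> set \<rho>" for v
    using N_path_line[OF \<rho>(3,2,1) low that] hd by simp
  obtain k where k: "k \<le> n - 2" "p = \<xi> i - 2 * int k"
    using hdV unfolding low_vertex_iff[OF i] by blast
  have noext: "(j, p - 1) \<notin> V" if "j = Suc i \<or> i = n - 2 \<and> j = n" for j
    using maximal_path_ends(2)[OF max N_arrow_rise, of "(j, p - 1)"] that i hdV
    unfolding hd N_arrow_iff by auto
  have fin: "k = n - 2 \<and> orbit (p + int i) = - \<epsilon> (Suc i) \<and> Suc i \<le> n - 2 + delta n Q"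
  proof (cases "i = n - 2")
    case False
    then have i': "1 \<le> Suc i" "Suc i \<le> n - 2" using i by auto
    have stop: "k = n - 2 \<and> \<xi> (Suc i) = \<xi> i + 1"
      by (rule low_neighbour_missing_left[OF i' low_neighbour_heights[OF i(1) i'(2)] k(1)])
        (use noext[of "Suc i"] k(2) in simp)
    then have o: "orbit (\<xi> i + int i + 2) = \<epsilon> (Suc i)" using orbit_Suc[OF i(1) i'(2)] by auto
    have "on_grid (\<xi> i + int i + 2)" using on_grid_add(1)[OF on_grid_low(1)[OF i], of 1] by simp
    then have "orbit (\<xi> i + int i + 2 - 2 * int (n - 1)) = - \<epsilon> (Suc i)"
      using orbit_antiperiodic o by simp
    moreover have eq: "\<xi> i + int i + 2 - 2 * int (n - 1) = p + int i"
      using k(2) stop n_facts(6,7) by simp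
    ultimately have "orbit (p + int i) = - \<epsilon> (Suc i)" by (simp only: eq)
    then show ?thesis using stop i' by linarith
  next
    case True
    have stop: "k = n - 2 \<and> \<xi> (n - 1) = \<xi> (n - 2) + 1 \<and> \<xi> n = \<xi> (n - 2) + 1"
      by (rule spin_neighbours_missing_left[OF k(1)])
        (use noext[of "n - 1"] noext[of n] k(2) True n_facts in auto)
    then have "p + int i = \<xi> (n - 2) - int n + 2" "tip n \<xi> = n - 1" "Suc i = n - 1"
      using k(2) True n_facts by (auto simp: tip_def)
    then show ?thesis using orbit_top(1) stop spin_delta by simp
  qed
  have sum: "summand n \<epsilon> (- \<epsilon> (Suc i)) (AR_root n \<epsilon> Q \<xi> \<tau> v)" if v: "v \<in> set \<rho>" for v
  proof -
    obtain j r where jr: "v = (j, r)" by fastforce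
    have j: "1 \<le> j" "j \<le> n - 2" "r + int j = p + int i" using line[OF v] i jr by auto
    have jV: "(j, r) \<in> V" using v \<rho>(2) jr by blast
    note root = AR_root_low[OF j(1,2) jV]
    obtain a where a: "a \<in> {1..n}" "orbit (r - int j) = \<epsilon> a \<or> orbit (r - int j) = - \<epsilon> a"
      using orbit_signed[OF root(4)] by blast
    have "Suc i \<in> {1..n}" using i n by auto
    then show ?thesis unfolding jr
      by (rule negative_summand[OF root(2) _ a(1)]) (use root(1) a(2) j(3) fin in auto)
  qed
  obtain j r where last: "last \<rho> = (j, r)" by fastforce
  have lastV: "(j, r) \<in> V" and lastS: "(j, r) \<in> set \<rho>" using \<rho> last by (metis last_in_set subsetD)+
  have j: "1 \<le> j" "j \<le> i" "r + int j = p + int i" using line[OF lastS] by auto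
  have j2: "j \<le> n - 2" using j(2) i by simp
  have "j = 1"
  proof (rule ccontr)
    assume "j \<noteq> 1"
    then obtain m where m: "j = Suc m" "1 \<le> m" using j(1) by (cases j) auto
    have mn: "m \<le> n - 2" "Suc m \<le> n - 2" using m j2 by auto
    \<comment> \<open>If the path ended at a level \<open>j > 1\<close>, then \<open>(j, r)\<close> would be the rightmost vertex of its level,
      and the path would have to descend by at least \<open>n - 2\<close> levels to get there from the left end.\<close>
    have "(m, r + 1) \<notin> V"
      using maximal_path_ends(1)[OF max N_arrow_rise, of "(m, r + 1)"] m mn lastV
      unfolding last N_arrow_iff by auto
    moreover obtain l where l: "l \<le> n - 2" "r = \<xi> j - 2 * int l"
      using lastV unfolding low_vertex_iff[OF j(1) j2] by blast
    moreover have "\<xi> m = \<xi> j + 1 \<or> \<xi> m = \<xi> j - 1"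
      using low_neighbour_heights[OF m(2) mn(2)] m(1) by auto
    ultimately have "l = 0"
      using low_neighbour_missing_right[OF m(2) mn(1), of j l] by simp
    then have "r = \<xi> j" using l(2) by simp
    moreover have "\<xi> j - int j \<ge> \<xi> i - int i" "\<xi> j + int j \<le> \<xi> i + int i"
      using height_chain.window_mono[OF xi_height_chain, of j i] j i by auto
    moreover have "p = \<xi> i - 2 * (int n - 2)" using fin k(2) n_facts(7) by simp
    ultimately have "\<xi> i - 2 * (int n - 2) + int i - int j - int j \<ge> \<xi> i - int i" using j(3) by simp
    moreover have "int i \<le> int n - 2" "1 \<le> int j" using i j(1) n by linarith+
    ultimately show False by simp
  qed
  then have "level (last \<rho>) = 1" using last by (simp add: level_def)
  then show ?thesis using fin sum by (intro conjI exI[of _ "Suc i"]) simp_all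
qed

end

theorem theorem1p23:
  fixes n :: nat
    and \<epsilon> :: "nat \<Rightarrow> 'a::real_inner"
    and Q :: "(nat \<times> nat) set"
    and \<xi> :: "nat \<Rightarrow> int"
    and \<tau> :: "'a \<Rightarrow> 'a"
  assumes "n \<ge> 4"
    and "orthonormal n \<epsilon>"
    and "dynkin_quiver n Q"
    and "height_function Q \<xi>"
    and "adapted_coxeter n \<epsilon> Q \<tau>"
  shows "(\<forall>\<rho>. shallow_maximal_S_path n \<epsilon> Q \<xi> \<tau> \<rho> \<longrightarrow>
            (\<exists>k. 1 \<le> k \<and> k \<le> n - 2 + delta n Q \<and>
                 (\<forall>v\<in>set \<rho>. summand n \<epsilon> (- \<epsilon> k) (AR_root n \<epsilon> Q \<xi> \<tau> v))) \<and>
            level (hd \<rho>) = 1) \<and>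
         (\<forall>\<rho>. shallow_maximal_N_path n \<epsilon> Q \<xi> \<tau> \<rho> \<longrightarrow>
            (\<exists>k. 1 \<le> k \<and> k \<le> n - 2 + delta n Q \<and>
                 (\<forall>v\<in>set \<rho>. summand n \<epsilon> (- \<epsilon> k) (AR_root n \<epsilon> Q \<xi> \<tau> v))) \<and>
            level (last \<rho>) = 1)"
proof -
  interpret ar_frame n \<epsilon> Q \<xi> \<tau>
    by unfold_locales (fact assms)+
  show ?thesis using shallow_S shallow_N by blast
qed

end
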